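(* Let $\varphi(z)=\frac{az+b}{cz+d}$ be a fractional linear map with $|a|^2+|b|^2+2|\bar a b-\bar c d|\le|c|^2+|d|^2$ and $|c|\le|d|$ (so that $\varphi$ maps $\mathbb{D}$ into $\mathbb{D}$), and consider $C_\varphi$ acting on the Hardy space $H^2$. Then, with $K=\overline{\varphi(\mathbb{D})}$, the limit $\beta(C_\varphi)=\lim_{n\to\infty}[a_n(C_\varphi)]^{1/n}$ exists and $\beta(C_\varphi)=\exp(-1/\operatorname{Cap}(K))$ (with the conventions $e^{-1/\infty}=1$, $e^{-1/0}=0$).
   Context: $H^2$ is the Hardy space of the unit disk $\mathbb{D}$; $C_\varphi f=f\circ\varphi$. Approximation numbers: $a_n(T)=\inf\{\|T-R\| : \operatorname{rank}R<n\}$. Green capacity: with $g(z,w)=\log\left|\frac{1-\bar w z}{z-w}\right|$, energy $I(\mu)=\iint g\,d\mu\,d\mu$, $V(E)=\inf I(\mu)$ over probability measures supported by a compact subset of $E\subseteq\mathbb{D}$, and $\operatorname{Cap}(E)=1/V(E)$. *)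

theory Defs
  imports "HOL-Probability.Probability"
begin

abbreviation unit_disk :: "complex set" where "unit_disk \<equiv> ball 0 1"

text \<open>Taylor coefficients at 0 and the Hardy space H^2 of the unit disk.
  Elements are represented by functions holomorphic on the disk and set to 0 outside it,
  so that H^2 is a genuine linear space of functions.\<close>
definition taylor_coeff :: "(complex \<Rightarrow> complex) \<Rightarrow> nat \<Rightarrow> complex" where
  "taylor_coeff f n = (deriv ^^ n) f 0 / fact n"

definition H2 :: "(complex \<Rightarrow> complex) set" where
  "H2 = {f. f holomorphic_on unit_disk \<and> (\<forall>z. z \<notin> unit_disk \<longrightarrow> f z = 0)
            \<and> summable (\<lambda>n. (cmod (taylor_coeff f n))\<^sup>2)}"

definition h2_norm :: "(complex \<Rightarrow> complex) \<Rightarrow> real" where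
  "h2_norm f = sqrt (\<Sum>n. (cmod (taylor_coeff f n))\<^sup>2)"

definition h2_opnorm :: "((complex \<Rightarrow> complex) \<Rightarrow> (complex \<Rightarrow> complex)) \<Rightarrow> ereal" where
  "h2_opnorm T = (SUP f\<in>{f\<in>H2. h2_norm f \<le> 1}. ereal (h2_norm (T f)))"

definition h2_linear_op :: "((complex \<Rightarrow> complex) \<Rightarrow> (complex \<Rightarrow> complex)) \<Rightarrow> bool" where
  "h2_linear_op R \<longleftrightarrow> (\<forall>f\<in>H2. R f \<in> H2) \<and>
     (\<forall>f\<in>H2. \<forall>g\<in>H2. R (\<lambda>z. f z + g z) = (\<lambda>z. R f z + R g z)) \<and>
     (\<forall>f\<in>H2. \<forall>c::complex. R (\<lambda>z. c * f z) = (\<lambda>z. c * R f z))"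

definition rank_less :: "((complex \<Rightarrow> complex) \<Rightarrow> (complex \<Rightarrow> complex)) \<Rightarrow> nat \<Rightarrow> bool" where
  "rank_less R n \<longleftrightarrow> (\<exists>B. finite B \<and> card B < n \<and>
      (\<forall>f\<in>H2. \<exists>c. R f = (\<lambda>z. \<Sum>b\<in>B. c b * b z)))"

definition approx_num_ext :: "((complex \<Rightarrow> complex) \<Rightarrow> (complex \<Rightarrow> complex)) \<Rightarrow> nat \<Rightarrow> ereal" where
  "approx_num_ext T n = (INF R\<in>{R. h2_linear_op R \<and> rank_less R n}.
                            h2_opnorm (\<lambda>f z. T f z - R f z))"

definition approx_num :: "((complex \<Rightarrow> complex) \<Rightarrow> (complex \<Rightarrow> complex)) \<Rightarrow> nat \<Rightarrow> real" where
  "approx_num T n = real_of_ereal (approx_num_ext T n)"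

definition comp_op :: "(complex \<Rightarrow> complex) \<Rightarrow> (complex \<Rightarrow> complex) \<Rightarrow> (complex \<Rightarrow> complex)" where
  "comp_op \<phi> f = (\<lambda>z. if z \<in> unit_disk then f (\<phi> z) else 0)"

definition green :: "complex \<Rightarrow> complex \<Rightarrow> ennreal" where
  "green z w = (if z = w then \<infinity> else ennreal (ln (cmod ((1 - cnj w * z) / (z - w)))))"

definition green_energy :: "complex measure \<Rightarrow> ennreal" where
  "green_energy \<mu> = (\<integral>\<^sup>+ z. (\<integral>\<^sup>+ w. green z w \<partial>\<mu>) \<partial>\<mu>)"

definition admissible_measures :: "complex set \<Rightarrow> complex measure set" where
  "admissible_measures E = {\<mu>. sets \<mu> = sets borel \<and> prob_space \<mu> \<and>
      (\<exists>L. compact L \<and> L \<subseteq> E \<inter> unit_disk \<and> emeasure \<mu> (UNIV - L) = 0)}"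

definition green_V :: "complex set \<Rightarrow> ennreal" where
  "green_V E = (INF \<mu>\<in>admissible_measures E. green_energy \<mu>)"

definition green_cap :: "complex set \<Rightarrow> ennreal" where
  "green_cap E = (if green_V E = 0 then \<infinity> else inverse (green_V E))"

definition exp_neg_inv :: "ennreal \<Rightarrow> real" where
  "exp_neg_inv c = (if c = \<infinity> then 1 else if c = 0 then 0 else exp (- 1 / enn2real c))"

end

theory Submission
  imports Defs "HOL-Complex_Analysis.Complex_Analysis"
begin

text \<open>
  The map \<open>\<phi>\<close> sends the unit disk bijectively onto a Euclidean disk of centre \<open>w\<close> and radius \<open>r\<close>
  with \<open>\<bar>w\<bar> + r \<le> 1\<close>.

  If \<open>\<bar>w\<bar> + r < 1\<close>, this disk is a pseudohyperbolic disk of some radius \<open>s < 1\<close>, so up to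
  automorphisms of the disk \<open>\<phi>\<close> is the dilation \<open>z \<mapsto> s z\<close>. Composition operators are bounded by
  Littlewood's subordination principle, hence the \<open>n\<close>-th approximation number is comparable to that of the
  dilation, the \<open>n\<close>-th largest entry of the diagonal operator with entries \<open>s ^ k\<close>. On the other
  side, the Green energy of a closed pseudohyperbolic disk of radius \<open>s\<close> is \<open>ln (1 / s)\<close>: the uniform
  measure on its boundary circle attains this value, and no measure does better because, after
  rescaling, the Green kernel of the unit disk exceeds \<open>ln (1 / s)\<close> by at least a positive definite
  kernel.

  If \<open>\<bar>w\<bar> + r = 1\<close>, the image contains pseudohyperbolic disks of every radius \<open>s < 1\<close>, and both sides
  equal \<open>1\<close>.
\<close>

section \<open>Taylor coefficients and Littlewood's inequality for polynomials\<close>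

text \<open>\<open>H2\<close> is encoded by Taylor coefficients alone, so the operator estimates are
  arranged as inequalities between finite sums of coefficients, which survive limits. This is why
  Littlewood's inequality is proved for polynomials, with an explicit harmonic majorant in place of
  a Poisson integral of boundary values, and then extended. Its constant 1 / (1 - |\<psi>(0)|) is
  not sharp, but constants disappear under n-th roots. So rough comparisons suffice: the operator of
  \<phi> factors through that of a dilation, and conversely. The converse inverts \<phi> on a
  pseudohyperbolic disk inside its image and therefore rests on injectivity. On the capacity side
  the obstacle is the infinite diagonal of the Green kernel: a measure may have infinite energy. The
  lower bound therefore integrates only a bounded minorant, a constant plus a finite sum of
  products. The truncation error is uniform only after rescaling by some s' > s, so two limits
  follow: in the truncation, then s' to s.\<close>

lemma taylor_coeff_fps: "f has_fps_expansion F \<Longrightarrow> taylor_coeff f n = fps_nth F n"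
  by (simp add: taylor_coeff_def fps_nth_fps_expansion)

lemma has_fps_expansion_taylor:
  assumes "f holomorphic_on unit_disk"
  shows "f has_fps_expansion Abs_fps (taylor_coeff f)"
proof -
  have "f has_fps_expansion fps_expansion f 0"
    using assms by (intro has_fps_expansion_fps_expansion[of unit_disk]) auto
  thus ?thesis by (simp add: fps_expansion_def taylor_coeff_def[abs_def])
qed

lemma taylor_coeff_cong:
  assumes "\<And>z. z \<in> unit_disk \<Longrightarrow> f z = g z"
  shows "taylor_coeff f n = taylor_coeff g n"
  unfolding taylor_coeff_def
  by (subst higher_deriv_cong_ev[where g = g and y = 0])
     (use assms in \<open>auto intro!: eventually_nhds_in_open[THEN eventually_mono, of unit_disk]\<close>)

lemma taylor_coeff_add:
  assumes "f holomorphic_on unit_disk" "g holomorphic_on unit_disk"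
  shows "taylor_coeff (\<lambda>z. f z + g z) n = taylor_coeff f n + taylor_coeff g n"
  by (subst taylor_coeff_fps[OF has_fps_expansion_add[OF assms[THEN has_fps_expansion_taylor]]]) simp

lemma taylor_coeff_diff:
  assumes "f holomorphic_on unit_disk" "g holomorphic_on unit_disk"
  shows "taylor_coeff (\<lambda>z. f z - g z) n = taylor_coeff f n - taylor_coeff g n"
  by (subst taylor_coeff_fps[OF has_fps_expansion_diff[OF assms[THEN has_fps_expansion_taylor]]]) simp

lemma taylor_coeff_cmult:
  assumes "f holomorphic_on unit_disk"
  shows "taylor_coeff (\<lambda>z. c * f z) n = c * taylor_coeff f n"
  by (subst taylor_coeff_fps[OF has_fps_expansion_cmult_left[OF has_fps_expansion_taylor[OF assms]]]) simp

lemma taylor_coeff_sum: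
  assumes "\<And>k. k \<in> A \<Longrightarrow> f k holomorphic_on unit_disk"
  shows "taylor_coeff (\<lambda>z. \<Sum>k\<in>A. f k z) n = (\<Sum>k\<in>A. taylor_coeff (f k) n)"
  by (subst taylor_coeff_fps[OF has_fps_expansion_sum[of A f "\<lambda>k. Abs_fps (taylor_coeff (f k))"]])
     (use assms in \<open>auto intro: has_fps_expansion_taylor simp: fps_sum_nth\<close>)

lemma taylor_coeff_power: "taylor_coeff (\<lambda>z. z ^ k) n = (if n = k then 1 else 0)"
  by (subst taylor_coeff_fps[OF has_fps_expansion_fps_X_power]) (auto simp: fps_X_power_nth)

lemma taylor_coeff_polynomial:
  "taylor_coeff (\<lambda>z. \<Sum>k<m. c k * z ^ k) n = (if n < m then c n else 0)"
proof -
  have "taylor_coeff (\<lambda>z. \<Sum>k<m. c k * z ^ k) n = (\<Sum>k<m. taylor_coeff (\<lambda>z. c k * z ^ k) n)"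
    by (intro taylor_coeff_sum holomorphic_intros)
  also have "\<dots> = (\<Sum>k<m. if k = n then c n else 0)"
    by (intro sum.cong refl, subst taylor_coeff_cmult)
       (auto intro!: holomorphic_intros simp: taylor_coeff_power)
  finally show ?thesis by simp
qed

lemma taylor_coeff_scale:
  assumes "f holomorphic_on unit_disk" "cmod s \<le> 1"
  shows "taylor_coeff (\<lambda>z. f (s * z)) n = s ^ n * taylor_coeff f n"
proof -
  have "(deriv ^^ n) (\<lambda>w. f (s * w)) 0 = s ^ n * (deriv ^^ n) f (s * 0)"
    using assms
    by (intro higher_deriv_compose_linear[of f unit_disk unit_disk])
       (auto simp: norm_mult intro: le_less_trans[OF mult_left_le_one_le])
  thus ?thesis by (simp add: taylor_coeff_def)
qed

section \<open>Cauchy integrals and Bessel's inequality on circles\<close>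

text \<open>The parameter makes one turn over [0,1], so integrals in \<open>t\<close> are circle
  means without a factor 2 pi.\<close>

definition circ :: "real \<Rightarrow> real \<Rightarrow> complex" where
  "circ r t = of_real r * exp (2 * of_real pi * \<i> * of_real t)"

lemma norm_circ [simp]: "cmod (circ r t) = \<bar>r\<bar>"
  by (simp add: circ_def norm_mult norm_exp_eq_Re)

lemma circ_eq_circlepath: "circ r = circlepath 0 r"
  by (simp add: circ_def circlepath fun_eq_iff)

lemma circ_integral_coeff:
  assumes "f holomorphic_on unit_disk" "0 < r" "r < 1"
  shows "((\<lambda>t. f (circ r t) / circ r t ^ n) has_integral taylor_coeff f n) {0..1}"
proof -
  have "((\<lambda>u. f u / (u - 0) ^ Suc n) has_contour_integral
          (2 * pi * \<i> / fact n) * (deriv ^^ n) f 0) (circlepath 0 r)"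
    using assms
    by (intro Cauchy_has_contour_integral_higher_derivative_circlepath)
       (auto intro!: holomorphic_on_imp_continuous_on elim: holomorphic_on_subset)
  hence int: "((\<lambda>t. f (circ r t) / circ r t ^ Suc n * vector_derivative (circlepath 0 r) (at t within {0..1}))
          has_integral (2 * pi * \<i>) * taylor_coeff f n) {0..1}"
    by (simp add: has_contour_integral_def circ_eq_circlepath taylor_coeff_def)
  \<comment> \<open>The derivative of the path is a multiple of \<open>circ r t\<close> and cancels
    one power of the Cauchy denominator.\<close>
  have "((\<lambda>t. f (circ r t) / circ r t ^ Suc n * (2 * pi * \<i> * circ r t))
          has_integral (2 * pi * \<i>) * taylor_coeff f n) {0..1}"
    by (rule has_integral_eq[OF _ int]) (simp add: vector_derivative_circlepath01 circ_def)
  from has_integral_mult_right[OF this, of "1 / (2 * pi * \<i>)"]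
  have "((\<lambda>t. 1 / (2 * pi * \<i>) * (f (circ r t) / circ r t ^ Suc n * (2 * pi * \<i> * circ r t)))
          has_integral taylor_coeff f n) {0..1}" by simp
  moreover have "1 / (2 * pi * \<i>) * (f (circ r t) / circ r t ^ Suc n * (2 * pi * \<i> * circ r t))
      = f (circ r t) / circ r t ^ n" for t
  proof -
    have "circ r t \<noteq> 0" using norm_circ[of r t] assms by force
    thus ?thesis by (simp add: field_simps)
  qed
  ultimately show ?thesis by simp
qed

lemma circ_mean_value:
  assumes "f holomorphic_on unit_disk" "0 < r" "r < 1"
  shows "((\<lambda>t. f (circ r t)) has_integral f 0) {0..1}"
  using circ_integral_coeff[OF assms, of 0] by (simp add: taylor_coeff_def)

text \<open>On |u| = r the conjugate of u^k is r^(2k) / u^k, so pairing with a polynomial is a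
  finite combination of Cauchy integrals, and no Taylor series of \<open>f\<close> has to be
  summed.\<close>

lemma circ_inner_polynomial:
  assumes f: "f holomorphic_on unit_disk" and r: "0 < r" "r < 1"
  shows "((\<lambda>t. f (circ r t) * cnj (\<Sum>k<m. c k * circ r t ^ k)) has_integral
           (\<Sum>k<m. taylor_coeff f k * cnj (c k) * of_real (r ^ (2 * k)))) {0..1}"
proof -
  have "((\<lambda>t. \<Sum>k<m. f (circ r t) / circ r t ^ k * (cnj (c k) * of_real (r ^ (2 * k))))
      has_integral (\<Sum>k<m. taylor_coeff f k * (cnj (c k) * of_real (r ^ (2 * k))))) {0..1}"
    by (intro has_integral_sum has_integral_mult_left circ_integral_coeff[OF f r]) auto
  moreover have "(\<Sum>k<m. f (circ r t) / circ r t ^ k * (cnj (c k) * of_real (r ^ (2 * k))))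
      = f (circ r t) * cnj (\<Sum>k<m. c k * circ r t ^ k)" for t
  proof -
    have nz: "circ r t \<noteq> 0" using norm_circ[of r t] r by force
    have "of_real (r ^ (2 * k)) = circ r t ^ k * cnj (circ r t) ^ k" for k
      using complex_norm_square[of "circ r t"] r
      by (simp add: power_mult flip: power_mult_distrib)
    thus ?thesis using nz by (simp add: sum_distrib_left field_simps)
  qed
  ultimately show ?thesis by (simp add: mult.assoc)
qed

text \<open>Integrate |f|^2 >= 2 Re (f cnj S) - |S|^2, where \<open>S\<close> is a Taylor polynomial
  of \<open>f\<close>: both pairings on the right equal \<open>Q\<close>. The majorant
  \<open>G\<close> stands for |f|^2 because in the application it is harmonic and its mean is
  known.\<close>

lemma bessel_circ:
  assumes f: "f holomorphic_on unit_disk" and r: "0 < r" "r < 1"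
    and G: "(G has_integral I) {0..1}" and le: "\<And>t. (cmod (f (circ r t)))\<^sup>2 \<le> G t"
  shows "(\<Sum>k<m. (cmod (taylor_coeff f k))\<^sup>2 * r ^ (2 * k)) \<le> I"
proof -
  define S where "S = (\<lambda>z. \<Sum>k<m. taylor_coeff f k * z ^ k)"
  have S: "S holomorphic_on unit_disk" unfolding S_def by (intro holomorphic_intros)
  define Q where "Q = (\<Sum>k<m. (cmod (taylor_coeff f k))\<^sup>2 * r ^ (2 * k))"
  have Q: "(\<Sum>k<m. taylor_coeff f k * cnj (taylor_coeff f k) * of_real (r ^ (2 * k))) = complex_of_real Q"
    unfolding Q_def by (simp flip: complex_norm_square)
  have 1: "((\<lambda>t. f (circ r t) * cnj (S (circ r t))) has_integral complex_of_real Q) {0..1}"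
    using circ_inner_polynomial[OF f r, where m = m and c = "taylor_coeff f"] by (simp only: Q S_def)
  have "((\<lambda>t. S (circ r t) * cnj (S (circ r t))) has_integral
     (\<Sum>k<m. taylor_coeff S k * cnj (taylor_coeff f k) * of_real (r ^ (2 * k)))) {0..1}"
    using circ_inner_polynomial[OF S r, where m = m and c = "taylor_coeff f"] by (simp only: S_def)
  also have "(\<Sum>k<m. taylor_coeff S k * cnj (taylor_coeff f k) * of_real (r ^ (2 * k))) = complex_of_real Q"
    unfolding Q[symmetric] by (intro sum.cong refl) (simp add: S_def taylor_coeff_polynomial)
  finally have 2: "((\<lambda>t. S (circ r t) * cnj (S (circ r t))) has_integral complex_of_real Q) {0..1}" .
  have "((\<lambda>t. 2 * Re (f (circ r t) * cnj (S (circ r t))) - Re (S (circ r t) * cnj (S (circ r t))))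
      has_integral 2 * Q - Q) {0..1}"
    by (intro has_integral_diff has_integral_mult_right)
       (use has_integral_linear[OF 1 bounded_linear_Re] has_integral_linear[OF 2 bounded_linear_Re]
          in \<open>simp_all add: o_def\<close>)
  moreover have "2 * Re (x * cnj y) - Re (y * cnj y) \<le> (cmod x)\<^sup>2" for x y
    using zero_le_power2[of "cmod (x - y)"] unfolding cmod_power2
    by (simp add: power2_eq_square algebra_simps)
  ultimately have "2 * Q - Q \<le> I"
    using le by (intro has_integral_le[OF _ G]) (auto intro: order_trans)
  thus ?thesis by (simp add: Q_def)
qed

section \<open>Littlewood subordination by a harmonic majorant\<close>

text \<open>Convexity of the square with weights 1 - |u| and |u|. These weights leave the factor |u|
  < 1 on the \<open>y\<close> term, so the estimate can be absorbed when summed along a recursion of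
  the form x + u y.\<close>

lemma weighted_square_le:
  fixes x y u :: complex
  assumes "cmod u < 1"
  shows "(cmod (x + u * y))\<^sup>2 \<le> (cmod x)\<^sup>2 / (1 - cmod u) + cmod u * (cmod y)\<^sup>2"
proof -
  define q X Y where "q = cmod u" and "X = cmod x" and "Y = cmod y"
  have q: "0 \<le> q" "q < 1" using assms by (auto simp: q_def)
  have "(cmod (x + u * y))\<^sup>2 \<le> (X + q * Y)\<^sup>2"
    unfolding q_def X_def Y_def
    by (intro power_mono order_trans[OF norm_triangle_ineq]) (auto simp: norm_mult)
  also have "\<dots> \<le> X\<^sup>2 / (1 - q) + q * Y\<^sup>2"
  proof -
    have "X\<^sup>2 + q * Y\<^sup>2 * (1 - q) - (X + q * Y)\<^sup>2 * (1 - q) = q * (X - (1 - q) * Y)\<^sup>2"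
      by algebra
    moreover have "\<dots> \<ge> 0" using q by simp
    ultimately show ?thesis using q by (simp add: field_simps)
  qed
  finally show ?thesis by (simp add: q_def X_def Y_def)
qed

text \<open>With \<open>g n u = (\<Sum>k. a (n + k) * u ^ k)\<close>, so that \<open>a n = g n u - u * g (n + 1) u\<close> and
  \<open>g 0 u\<close> is the value of the polynomial, the real part of the majorant is
  \<open>\<Sum>n. \<bar>g n\<bar>\<^sup>2 - \<bar>u\<bar>\<^sup>2 * \<bar>g (n + 1)\<bar>\<^sup>2\<close>.\<close>

lemma polynomial_harmonic_majorant:
  fixes a :: "nat \<Rightarrow> complex"
  obtains F where "F holomorphic_on UNIV"
    and "\<And>u. cmod u < 1 \<Longrightarrow> (cmod (\<Sum>k<N. a k * u ^ k))\<^sup>2 \<le> Re (F u)"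
    and "\<And>u. cmod u < 1 \<Longrightarrow> Re (F u) \<le> (\<Sum>k<N. (cmod (a k))\<^sup>2) / (1 - cmod u)\<^sup>2"
proof -
  define g where "g = (\<lambda>n u. \<Sum>k<N - n. a (n + k) * u ^ k)"
  define F where "F = (\<lambda>u. \<Sum>n<N. (g n u + u * g (Suc n) u) * cnj (a n))"
  have rec: "g n u = a n + u * g (Suc n) u" if "n < N" for n u
  proof -
    have "N - n = Suc (N - Suc n)" using that by simp
    thus ?thesis by (simp add: g_def sum.lessThan_Suc_shift sum_distrib_left algebra_simps del: sum.lessThan_Suc)
  qed
  have gN: "g N u = 0" for u by (simp add: g_def)
  have ReF: "Re (F u) = (\<Sum>n<N. (cmod (g n u))\<^sup>2 - (cmod u)\<^sup>2 * (cmod (g (Suc n) u))\<^sup>2)" for u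
  proof -
    have "Re ((g n u + u * g (Suc n) u) * cnj (a n)) =
        (cmod (g n u))\<^sup>2 - (cmod u)\<^sup>2 * (cmod (g (Suc n) u))\<^sup>2" if "n < N" for n
    proof -
      \<comment> \<open>Applied with x = \<open>g n u\<close> and y =
        \<open>u * g (Suc n) u\<close>, so that x - y = \<open>a n\<close>; the cross terms are
        purely imaginary.\<close>
      have "Re ((x + y) * cnj (x - y)) = (cmod x)\<^sup>2 - (cmod y)\<^sup>2" for x y
        unfolding cmod_power2 by (simp add: power2_eq_square algebra_simps)
      moreover have "a n = g n u - u * g (Suc n) u" using rec[OF that] by simp
      ultimately show ?thesis by (simp only: norm_mult power_mult_distrib)
    qed
    thus ?thesis by (simp add: F_def)
  qed
  show thesis
  proof (rule that)
    show "F holomorphic_on UNIV" unfolding F_def g_def by (intro holomorphic_intros)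
  next
    fix u :: complex assume u: "cmod u < 1"
    have "(cmod (g 0 u))\<^sup>2 = (\<Sum>n<N. (cmod (g n u))\<^sup>2 - (cmod (g (Suc n) u))\<^sup>2)"
      by (subst sum_lessThan_telescope') (simp add: gN)
    also have "\<dots> \<le> Re (F u)"
      unfolding ReF using u
      by (intro sum_mono diff_left_mono mult_left_le_one_le) (auto simp: power_le_one)
    finally show "(cmod (\<Sum>k<N. a k * u ^ k))\<^sup>2 \<le> Re (F u)" by (simp add: g_def)
  next
    fix u :: complex assume u: "cmod u < 1"
    define W where "W = (\<Sum>n<N. (cmod (g n u))\<^sup>2)"
    define A where "A = (\<Sum>k<N. (cmod (a k))\<^sup>2)"
    \<comment> \<open>The index shift loses only the nonnegative term at \<open>n = 0\<close>, so
      \<open>W\<close> reappears on the right with factor |u|. Solving for \<open>W\<close> produces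
      the second factor 1 / (1 - |u|).\<close>
    have "W \<le> (\<Sum>n<N. (cmod (a n))\<^sup>2 / (1 - cmod u) + cmod u * (cmod (g (Suc n) u))\<^sup>2)"
      unfolding W_def by (intro sum_mono) (simp add: rec weighted_square_le u)
    also have "\<dots> = A / (1 - cmod u) + cmod u * (\<Sum>n<N. (cmod (g (Suc n) u))\<^sup>2)"
      by (simp add: A_def sum.distrib sum_divide_distrib sum_distrib_left)
    also have "\<dots> \<le> A / (1 - cmod u) + cmod u * W"
    proof (intro add_left_mono mult_left_mono)
      have "(\<Sum>n<N. (cmod (g (Suc n) u))\<^sup>2) - W = (\<Sum>n<N. (cmod (g (Suc n) u))\<^sup>2 - (cmod (g n u))\<^sup>2)"
        by (simp add: W_def sum_subtractf)
      also have "\<dots> = - (cmod (g 0 u))\<^sup>2" by (subst sum_lessThan_telescope) (simp add: gN)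
      finally show "(\<Sum>n<N. (cmod (g (Suc n) u))\<^sup>2) \<le> W" by (smt (verit) zero_le_power2)
    qed simp
    finally have "W \<le> A / (1 - cmod u) + cmod u * W" .
    hence "W * (1 - cmod u) \<le> A / (1 - cmod u)" by (simp add: algebra_simps)
    hence "W \<le> A / (1 - cmod u)\<^sup>2"
      using u by (simp add: pos_le_divide_eq power2_eq_square mult.assoc)
    moreover have "Re (F u) \<le> W" unfolding ReF W_def by (intro sum_mono) simp
    ultimately show "Re (F u) \<le> (\<Sum>k<N. (cmod (a k))\<^sup>2) / (1 - cmod u)\<^sup>2"
      by (simp add: A_def)
  qed
qed

text \<open>The square of the modulus of the composite is dominated by Re (F o \<psi>), a harmonic
  function whose mean over every circle is its value at 0. This bounds the coefficient sums with
  weights r^(2n) independently of r, and r -> 1 removes the weights; only finitely many coefficients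
  occur in that limit.\<close>

lemma littlewood_polynomial:
  fixes a :: "nat \<Rightarrow> complex"
  assumes hol: "\<psi> holomorphic_on unit_disk" and maps: "\<psi> ` unit_disk \<subseteq> unit_disk"
  shows "(\<Sum>n<m. (cmod (taylor_coeff (\<lambda>z. \<Sum>k<N. a k * \<psi> z ^ k) n))\<^sup>2)
           \<le> (\<Sum>k<N. (cmod (a k))\<^sup>2) / (1 - cmod (\<psi> 0))\<^sup>2"
proof -
  obtain F where F: "F holomorphic_on UNIV"
    "\<And>u. cmod u < 1 \<Longrightarrow> (cmod (\<Sum>k<N. a k * u ^ k))\<^sup>2 \<le> Re (F u)"
    "\<And>u. cmod u < 1 \<Longrightarrow> Re (F u) \<le> (\<Sum>k<N. (cmod (a k))\<^sup>2) / (1 - cmod u)\<^sup>2"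
    using polynomial_harmonic_majorant[of a N] by blast
  define h where "h = (\<lambda>z. \<Sum>k<N. a k * \<psi> z ^ k)"
  have h: "h holomorphic_on unit_disk" unfolding h_def by (intro holomorphic_intros hol)
  have \<psi>: "cmod (\<psi> z) < 1" if "cmod z < 1" for z using maps that by force
  have Fh: "(\<lambda>z. F (\<psi> z)) holomorphic_on unit_disk"
    using holomorphic_on_compose[OF hol holomorphic_on_subset[OF F(1)]] by (simp add: o_def)
  have r_bound: "(\<Sum>n<m. (cmod (taylor_coeff h n))\<^sup>2 * r ^ (2 * n)) \<le> Re (F (\<psi> 0))"
    if r: "0 < r" "r < 1" for r
  proof (rule bessel_circ[OF h r])
    show "((\<lambda>t. Re (F (\<psi> (circ r t)))) has_integral Re (F (\<psi> 0))) {0..1}"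
      using has_integral_linear[OF circ_mean_value[OF Fh r] bounded_linear_Re] by (simp add: o_def)
    show "(cmod (h (circ r t)))\<^sup>2 \<le> Re (F (\<psi> (circ r t)))" for t
      unfolding h_def by (intro F(2) \<psi>) (use r in simp)
  qed
  have "((\<lambda>r. \<Sum>n<m. (cmod (taylor_coeff h n))\<^sup>2 * r ^ (2 * n)) \<longlongrightarrow>
          (\<Sum>n<m. (cmod (taylor_coeff h n))\<^sup>2 * 1 ^ (2 * n))) (at_left 1)"
    by (intro tendsto_intros)
  moreover have "eventually (\<lambda>r::real. 0 < r \<and> r < 1) (at_left 1)"
    by (intro eventually_conj eventually_at_leftI[of 0]) auto
  ultimately have "(\<Sum>n<m. (cmod (taylor_coeff h n))\<^sup>2 * 1 ^ (2 * n)) \<le> Re (F (\<psi> 0))"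
    by (intro tendsto_upperbound[where F = "at_left (1::real)"]) (auto elim!: eventually_mono intro: r_bound)
  also have "\<dots> \<le> (\<Sum>k<N. (cmod (a k))\<^sup>2) / (1 - cmod (\<psi> 0))\<^sup>2" by (intro F(3) \<psi>) simp
  finally show ?thesis by (simp add: h_def)
qed

section \<open>Composition operators on the Hardy space\<close>

lemma scale_less_one:
  fixes s x :: real
  shows "0 < s \<Longrightarrow> s \<le> 1 \<Longrightarrow> 0 \<le> x \<Longrightarrow> x < 1 \<Longrightarrow> s * x < 1"
  using mult_left_le_one_le[of x s] by simp

lemma H2_holomorphic: "f \<in> H2 \<Longrightarrow> f holomorphic_on unit_disk"
  by (simp add: H2_def)

lemma H2_summable: "f \<in> H2 \<Longrightarrow> summable (\<lambda>n. (cmod (taylor_coeff f n))\<^sup>2)"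
  by (simp add: H2_def)

lemma h2_norm_nonneg: "f \<in> H2 \<Longrightarrow> 0 \<le> h2_norm f"
  by (simp add: h2_norm_def suminf_nonneg H2_summable)

lemma h2_norm_sq: "f \<in> H2 \<Longrightarrow> (h2_norm f)\<^sup>2 = (\<Sum>n. (cmod (taylor_coeff f n))\<^sup>2)"
  by (simp add: h2_norm_def suminf_nonneg H2_summable)

lemma H2_I:
  assumes "f holomorphic_on unit_disk" "\<And>z. z \<notin> unit_disk \<Longrightarrow> f z = 0"
    and "\<And>m. (\<Sum>n<m. (cmod (taylor_coeff f n))\<^sup>2) \<le> C\<^sup>2" and "0 \<le> C"
  shows "f \<in> H2" "h2_norm f \<le> C"
proof -
  have s: "summable (\<lambda>n. (cmod (taylor_coeff f n))\<^sup>2)"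
    by (rule summableI_nonneg_bounded[OF _ assms(3)]) simp
  thus "f \<in> H2" using assms by (simp add: H2_def)
  have "(\<Sum>n. (cmod (taylor_coeff f n))\<^sup>2) \<le> C\<^sup>2" by (rule suminf_le_const[OF s assms(3)])
  thus "h2_norm f \<le> C" unfolding h2_norm_def using \<open>0 \<le> C\<close> by (intro real_le_lsqrt)
qed

lemma H2_cmult: "f \<in> H2 \<Longrightarrow> (\<lambda>z. c * f z) \<in> H2"
  by (auto simp: H2_def taylor_coeff_cmult norm_mult power_mult_distrib
        intro!: holomorphic_intros summable_mult)

lemma H2_add:
  assumes "f \<in> H2" "g \<in> H2"
  shows "(\<lambda>z. f z + g z) \<in> H2"
proof -
  have "summable (\<lambda>n. (cmod (taylor_coeff f n + taylor_coeff g n))\<^sup>2)"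
  proof (rule summable_comparison_test_ev)
    show "summable (\<lambda>n. 2 * (cmod (taylor_coeff f n))\<^sup>2 + 2 * (cmod (taylor_coeff g n))\<^sup>2)"
      using assms by (intro summable_add summable_mult H2_summable)
    show "\<forall>\<^sub>F n in sequentially. norm ((cmod (taylor_coeff f n + taylor_coeff g n))\<^sup>2)
        \<le> 2 * (cmod (taylor_coeff f n))\<^sup>2 + 2 * (cmod (taylor_coeff g n))\<^sup>2"
    proof (rule always_eventually, rule allI)
      fix n
      have "(cmod (x + y))\<^sup>2 \<le> 2 * (cmod x)\<^sup>2 + 2 * (cmod y)\<^sup>2" for x y
        using zero_le_power2[of "cmod (x - y)"] unfolding cmod_power2
        by (simp add: power2_eq_square algebra_simps)
      thus "norm ((cmod (taylor_coeff f n + taylor_coeff g n))\<^sup>2)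
        \<le> 2 * (cmod (taylor_coeff f n))\<^sup>2 + 2 * (cmod (taylor_coeff g n))\<^sup>2" by simp
    qed
  qed
  thus ?thesis using assms
    by (auto simp: H2_def taylor_coeff_add intro!: holomorphic_intros)
qed

lemma H2_zero: "(\<lambda>z. 0) \<in> H2"
  using H2_I(1)[of "\<lambda>z. 0" 0] taylor_coeff_polynomial[of "\<lambda>_. 0" 0] by simp

lemma H2_diff: "f \<in> H2 \<Longrightarrow> g \<in> H2 \<Longrightarrow> (\<lambda>z. f z - g z) \<in> H2"
  using H2_add[of f "\<lambda>z. - 1 * g z"] H2_cmult[of g "- 1"] by simp

lemma H2_sum: "(\<And>k. k \<in> A \<Longrightarrow> f k \<in> H2) \<Longrightarrow> (\<lambda>z. \<Sum>k\<in>A. f k z) \<in> H2"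
  by (induction A rule: infinite_finite_induct) (auto intro: H2_zero H2_add)

text \<open>Taylor polynomials of \<open>f\<close>, composed with \<psi>, converge uniformly near 0,
  hence each Taylor coefficient converges. The polynomial bound, for a fixed finite number
  \<open>m\<close> of coefficients, passes to the limit and is uniform in \<open>m\<close>.\<close>

proposition comp_op_H2:
  assumes hol: "\<psi> holomorphic_on unit_disk" and maps: "\<psi> ` unit_disk \<subseteq> unit_disk"
    and f: "f \<in> H2"
  shows "comp_op \<psi> f \<in> H2" and "h2_norm (comp_op \<psi> f) \<le> h2_norm f / (1 - cmod (\<psi> 0))"
proof -
  define a where "a = taylor_coeff f"
  define P where "P = (\<lambda>N z. \<Sum>k<N. a k * \<psi> z ^ k)"
  have fhol: "f holomorphic_on unit_disk" by (rule H2_holomorphic[OF f])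
  have \<psi>: "cmod (\<psi> z) < 1" if "cmod z < 1" for z using maps that by force
  have fs: "(\<lambda>k. a k * z ^ k) sums f z" if "cmod z < 1" for z
    using holomorphic_power_series[OF fhol, of z] that by (simp add: a_def taylor_coeff_def)
  \<comment> \<open>Any radius below 1 would do: coefficients at 0 need convergence near 0 only, and
    \<psi> maps the smaller closed disk into a disk of radius \<rho> < 1.\<close>
  have "\<exists>x\<in>cball 0 (1/2). \<forall>y\<in>cball 0 (1/2). cmod (\<psi> y) \<le> cmod (\<psi> x)"
    by (intro continuous_attains_sup continuous_intros continuous_on_subset[OF holomorphic_on_imp_continuous_on[OF hol]])
       auto
  then obtain x0 where x0: "cmod x0 \<le> 1 / 2" "\<And>y. cmod y \<le> 1 / 2 \<Longrightarrow> cmod (\<psi> y) \<le> cmod (\<psi> x0)"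
    by auto
  define \<rho> where "\<rho> = cmod (\<psi> x0)"
  have \<rho>: "\<rho> < 1" "0 \<le> \<rho>" using \<psi>[of x0] x0(1) by (auto simp: \<rho>_def)
  have \<psi>\<rho>: "\<psi> \<in> ball 0 (1/2) \<rightarrow> cball 0 \<rho>" using x0(2) by (auto simp: \<rho>_def)
  \<comment> \<open>The midpoint of \<rho> and 1 is a point of convergence beyond \<rho>, so the
    radius of convergence strictly exceeds \<rho>.\<close>
  have "ereal (cmod (of_real ((1 + \<rho>) / 2))) \<le> conv_radius a"
    by (rule conv_radius_geI, rule sums_summable[OF fs], subst norm_of_real) (use \<rho> in auto)
  moreover have "ereal \<rho> < ereal (cmod (of_real ((1 + \<rho>) / 2)))"
    using \<rho> by (subst norm_of_real) auto
  ultimately have "ereal \<rho> < conv_radius a" by (rule less_le_trans[rotated])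
  hence "uniform_limit (cball 0 \<rho>) (\<lambda>N x. \<Sum>k<N. a k * (x - 0) ^ k) (\<lambda>x. \<Sum>k. a k * (x - 0) ^ k) sequentially"
    by (rule powser_uniform_limit)
  hence "uniform_limit (ball 0 (1/2)) P (\<lambda>z. \<Sum>k. a k * (\<psi> z - 0) ^ k) sequentially"
    unfolding P_def using uniform_limit_compose'[OF _ \<psi>\<rho>] by fastforce
  also have "?this \<longleftrightarrow> uniform_limit (ball 0 (1/2)) P (comp_op \<psi> f) sequentially"
    using sums_unique[OF fs[OF \<psi>]] by (intro uniform_limit_cong) (auto simp: comp_op_def)
  finally have ul: "uniform_limit (ball 0 (1/2)) P (comp_op \<psi> f) sequentially" .
  have lim: "(\<lambda>N. taylor_coeff (P N) n) \<longlonglongrightarrow> taylor_coeff (comp_op \<psi> f) n" for n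
    unfolding taylor_coeff_def
    by (intro tendsto_divide tendsto_const higher_deriv_complex_uniform_limit[OF ul] always_eventually allI)
       (auto simp: P_def intro!: holomorphic_intros holomorphic_on_subset[OF hol])
  have p: "cmod (\<psi> 0) < 1" by (rule \<psi>) simp
  define C where "C = h2_norm f / (1 - cmod (\<psi> 0))"
  have C: "0 \<le> C" using p h2_norm_nonneg[OF f] by (simp add: C_def)
  have bound: "(\<Sum>n<m. (cmod (taylor_coeff (comp_op \<psi> f) n))\<^sup>2) \<le> C\<^sup>2" for m
  proof (rule tendsto_upperbound)
    show "(\<lambda>N. \<Sum>n<m. (cmod (taylor_coeff (P N) n))\<^sup>2) \<longlonglongrightarrow> (\<Sum>n<m. (cmod (taylor_coeff (comp_op \<psi> f) n))\<^sup>2)"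
      by (intro tendsto_intros lim)
    have "(\<Sum>n<m. (cmod (taylor_coeff (P N) n))\<^sup>2) \<le> C\<^sup>2" for N
    proof -
      have "(\<Sum>n<m. (cmod (taylor_coeff (P N) n))\<^sup>2) \<le> (\<Sum>k<N. (cmod (a k))\<^sup>2) / (1 - cmod (\<psi> 0))\<^sup>2"
        unfolding P_def by (rule littlewood_polynomial[OF hol maps])
      also have "\<dots> \<le> (h2_norm f)\<^sup>2 / (1 - cmod (\<psi> 0))\<^sup>2"
        unfolding h2_norm_sq[OF f] a_def
        by (intro divide_right_mono sum_le_suminf H2_summable[OF f]) auto
      finally show ?thesis by (simp add: C_def power_divide)
    qed
    thus "\<forall>\<^sub>F N in sequentially. (\<Sum>n<m. (cmod (taylor_coeff (P N) n))\<^sup>2) \<le> C\<^sup>2" by simp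
  qed simp
  have "comp_op \<psi> f holomorphic_on unit_disk"
    using holomorphic_on_compose_gen[OF hol fhol maps]
    by (rule holomorphic_transform) (simp add: comp_op_def)
  from H2_I[OF this _ bound C]
  show "comp_op \<psi> f \<in> H2" "h2_norm (comp_op \<psi> f) \<le> h2_norm f / (1 - cmod (\<psi> 0))"
    by (auto simp: comp_op_def C_def)
qed

section \<open>Approximation numbers from above\<close>

definition disk_monomial :: "nat \<Rightarrow> complex \<Rightarrow> complex" where
  "disk_monomial k z = (if z \<in> unit_disk then z ^ k else 0)"

lemma taylor_coeff_disk_polynomial:
  "taylor_coeff (\<lambda>z. \<Sum>k<m. c k * disk_monomial k z) n = (if n < m then c n else 0)"
  by (subst taylor_coeff_cong[where g = "\<lambda>z. \<Sum>k<m. c k * z ^ k"])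
     (auto simp: disk_monomial_def taylor_coeff_polynomial)

lemma disk_polynomial_H2: "(\<lambda>z. \<Sum>k<m. c k * disk_monomial k z) \<in> H2"
proof -
  have "(\<lambda>z. \<Sum>k<m. c k * z ^ k) holomorphic_on unit_disk" by (intro holomorphic_intros)
  hence "(\<lambda>z. \<Sum>k<m. c k * disk_monomial k z) holomorphic_on unit_disk"
    by (rule holomorphic_transform) (simp add: disk_monomial_def)
  moreover have "summable (\<lambda>n. (cmod (taylor_coeff (\<lambda>z. \<Sum>k<m. c k * disk_monomial k z) n))\<^sup>2)"
    by (rule summable_finite[of "{..<m}"]) (auto simp: taylor_coeff_disk_polynomial)
  ultimately show ?thesis by (auto simp: H2_def disk_monomial_def)
qed

lemma disk_monomial_H2: "disk_monomial k \<in> H2"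
  using disk_polynomial_H2[where m = "Suc k" and c = "\<lambda>j. if j = k then 1 else 0"]
  by (simp add: if_distrib[of "\<lambda>x. x * _"] cong: if_cong)

lemma comp_op_sum: "comp_op \<psi> (\<lambda>z. \<Sum>k\<in>A. c k * f k z) = (\<lambda>z. \<Sum>k\<in>A. c k * comp_op \<psi> (f k) z)"
  by (auto simp: comp_op_def fun_eq_iff)

lemma approx_num_le:
  assumes R: "h2_linear_op R" "rank_less R n" and C: "0 \<le> C"
    and bound: "\<And>f. f \<in> H2 \<Longrightarrow> h2_norm f \<le> 1 \<Longrightarrow> h2_norm (\<lambda>z. T f z - R f z) \<le> C"
  shows "approx_num_ext T n \<le> ereal C"
proof -
  have "approx_num_ext T n \<le> h2_opnorm (\<lambda>f z. T f z - R f z)"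
    unfolding approx_num_ext_def using R by (intro INF_lower) auto
  also have "\<dots> \<le> ereal C" unfolding h2_opnorm_def using bound by (intro SUP_least) auto
  finally show ?thesis .
qed

text \<open>The operator of \<phi> acts as composition with \<psi>, then the diagonal operator with
  entries s^k, then composition with \<tau>. Keeping the first \<open>m\<close> diagonal entries
  gives rank at most \<open>m\<close>, which is \<open>rank_less\<close> at \<open>Suc m\<close>;
  the discarded tail has norm at most s^m, and the two outer factors contribute
  \<open>C\<close>.\<close>

proposition approx_num_comp_op_le:
  fixes s :: real
  assumes \<tau>: "\<tau> holomorphic_on unit_disk" "\<tau> ` unit_disk \<subseteq> unit_disk"
    and \<psi>: "\<psi> holomorphic_on unit_disk" "\<psi> ` unit_disk \<subseteq> unit_disk"
    and s: "0 < s" "s \<le> 1"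
    and \<phi>: "\<And>z. z \<in> unit_disk \<Longrightarrow> \<phi> z = \<psi> (of_real s * \<tau> z)"
  obtains C where "\<And>m. approx_num_ext (comp_op \<phi>) (Suc m) \<le> ereal (C * s ^ m)"
proof
  define C where "C = 1 / (1 - cmod (\<tau> 0)) * (1 / (1 - cmod (\<psi> 0)))"
  have \<tau>0: "cmod (\<tau> 0) < 1" using \<tau>(2) by force
  have \<psi>0: "cmod (\<psi> 0) < 1" using \<psi>(2) by force
  fix m :: nat
  define R where "R = (\<lambda>f z. \<Sum>k<m. (taylor_coeff (comp_op \<psi> f) k * s ^ k) * comp_op \<tau> (disk_monomial k) z)"
  have \<tau>m: "comp_op \<tau> (disk_monomial k) \<in> H2" for k by (intro comp_op_H2 \<tau> disk_monomial_H2)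
  have \<psi>H: "comp_op \<psi> f \<in> H2" if "f \<in> H2" for f by (intro comp_op_H2 \<psi> that)
  show "approx_num_ext (comp_op \<phi>) (Suc m) \<le> ereal (C * s ^ m)"
  proof (rule approx_num_le)
    show "h2_linear_op R" unfolding h2_linear_op_def
    proof (intro conjI ballI allI)
      fix f assume f: "f \<in> H2"
      show "R f \<in> H2" unfolding R_def by (intro H2_sum H2_cmult \<tau>m)
      fix g assume g: "g \<in> H2"
      have "comp_op \<psi> (\<lambda>z. f z + g z) = (\<lambda>z. comp_op \<psi> f z + comp_op \<psi> g z)"
        by (auto simp: comp_op_def)
      thus "R (\<lambda>z. f z + g z) = (\<lambda>z. R f z + R g z)"
        using f g \<psi>H by (simp add: R_def taylor_coeff_add H2_holomorphic sum.distrib algebra_simps)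
    next
      fix f c assume f: "f \<in> H2"
      have "comp_op \<psi> (\<lambda>z. c * f z) = (\<lambda>z. c * comp_op \<psi> f z)"
        by (auto simp: comp_op_def)
      thus "R (\<lambda>z. c * f z) = (\<lambda>z. c * R f z)"
        using f \<psi>H by (simp add: R_def taylor_coeff_cmult H2_holomorphic sum_distrib_left algebra_simps)
    qed
    show "rank_less R (Suc m)" unfolding rank_less_def
    proof (intro exI conjI ballI)
      let ?h = "\<lambda>k. comp_op \<tau> (disk_monomial k)"
      show "finite (?h ` {..<m})" by simp
      show "card (?h ` {..<m}) < Suc m" using card_image_le[of "{..<m}" ?h] by simp
      fix f assume "f \<in> H2"
      let ?x = "\<lambda>k. taylor_coeff (comp_op \<psi> f) k * s ^ k"
      \<comment> \<open>The functions \<open>?h k\<close> need not be distinct, whereas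
        \<open>rank_less\<close> sums over a set; coefficients with the same function are added
        up.\<close>
      show "R f = (\<lambda>z. \<Sum>b\<in>?h ` {..<m}. (\<Sum>k | k \<in> {..<m} \<and> ?h k = b. ?x k) * b z)"
      proof
        fix z
        have "R f z = (\<Sum>b\<in>?h ` {..<m}. \<Sum>k | k \<in> {..<m} \<and> ?h k = b. ?x k * ?h k z)"
          unfolding R_def by (rule sum.image_gen) simp
        also have "\<dots> = (\<Sum>b\<in>?h ` {..<m}. (\<Sum>k | k \<in> {..<m} \<and> ?h k = b. ?x k) * b z)"
          unfolding sum_distrib_right by (intro sum.cong refl) auto
        finally show "R f z = \<dots>" .
      qed
    qed
    show "0 \<le> C * s ^ m" using \<tau>0 \<psi>0 s by (simp add: C_def)
  next
    fix f assume f: "f \<in> H2" "h2_norm f \<le> 1"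
    define G where "G = comp_op \<psi> f"
    have G: "G \<in> H2" using \<psi>H f by (simp add: G_def)
    define E where "E = comp_op (\<lambda>z. of_real s * z) G"
    have E: "E \<in> H2" unfolding E_def
      by (intro comp_op_H2 G holomorphic_intros)
         (use s in \<open>auto simp: norm_mult intro!: scale_less_one\<close>)
    have Ec: "taylor_coeff E k = s ^ k * taylor_coeff G k" for k
    proof -
      have "taylor_coeff E k = taylor_coeff (\<lambda>z. G (of_real s * z)) k"
        by (rule taylor_coeff_cong) (simp add: E_def comp_op_def)
      thus ?thesis using s H2_holomorphic[OF G] by (simp add: taylor_coeff_scale)
    qed
    define g where "g = (\<lambda>z. E z - (\<Sum>k<m. (taylor_coeff G k * s ^ k) * disk_monomial k z))"
    have g: "g \<in> H2" unfolding g_def by (intro H2_diff E disk_polynomial_H2)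
    have gc: "taylor_coeff g k = (if k < m then 0 else s ^ k * taylor_coeff G k)" for k
      unfolding g_def
      by (subst taylor_coeff_diff)
         (auto intro!: H2_holomorphic E disk_polynomial_H2 simp: taylor_coeff_disk_polynomial Ec)
    have "h2_norm g \<le> s ^ m * h2_norm G"
    proof (rule H2_I(2))
      show "(\<Sum>k<n. (cmod (taylor_coeff g k))\<^sup>2) \<le> (s ^ m * h2_norm G)\<^sup>2" for n
      proof -
        have "(\<Sum>k<n. (cmod (taylor_coeff g k))\<^sup>2) \<le> (\<Sum>k<n. (s ^ m)\<^sup>2 * (cmod (taylor_coeff G k))\<^sup>2)"
        proof (intro sum_mono)
          fix k
          show "(cmod (taylor_coeff g k))\<^sup>2 \<le> (s ^ m)\<^sup>2 * (cmod (taylor_coeff G k))\<^sup>2"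
            using s by (cases "k < m")
              (auto simp: gc norm_mult norm_power power_mult_distrib intro!: mult_right_mono power_mono power_decreasing)
        qed
        also have "\<dots> = (s ^ m)\<^sup>2 * (\<Sum>k<n. (cmod (taylor_coeff G k))\<^sup>2)" by (simp add: sum_distrib_left)
        also have "\<dots> \<le> (s ^ m)\<^sup>2 * (h2_norm G)\<^sup>2"
          unfolding h2_norm_sq[OF G] by (intro mult_left_mono sum_le_suminf H2_summable G) auto
        finally show ?thesis by (simp add: power_mult_distrib)
      qed
    qed (use g s h2_norm_nonneg[OF G] in \<open>auto simp: H2_def\<close>)
    also have "\<dots> \<le> s ^ m * (1 / (1 - cmod (\<psi> 0)))"
    proof (intro mult_left_mono)
      have "h2_norm G \<le> h2_norm f / (1 - cmod (\<psi> 0))"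
        unfolding G_def by (rule comp_op_H2(2)[OF \<psi> f(1)])
      also have "\<dots> \<le> 1 / (1 - cmod (\<psi> 0))" using f(2) \<psi>0 by (intro divide_right_mono) auto
      finally show "h2_norm G \<le> 1 / (1 - cmod (\<psi> 0))" .
    qed (use s in simp)
    finally have gn: "h2_norm g \<le> s ^ m * (1 / (1 - cmod (\<psi> 0)))" .
    have "(\<lambda>z. comp_op \<phi> f z - R f z) = comp_op \<tau> g"
    proof
      fix z
      show "comp_op \<phi> f z - R f z = comp_op \<tau> g z"
      proof (cases "z \<in> unit_disk")
        case True
        have t: "cmod (\<tau> z) < 1" using \<tau>(2) True by force
        hence "cmod (s * \<tau> z) < 1"
          using s by (auto simp: norm_mult intro!: scale_less_one)
        thus ?thesis using True t \<phi>[OF True]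
          by (simp add: g_def E_def G_def R_def comp_op_def)
      next
        case False thus ?thesis by (simp add: comp_op_def R_def)
      qed
    qed
    hence "h2_norm (\<lambda>z. comp_op \<phi> f z - R f z) \<le> h2_norm g / (1 - cmod (\<tau> 0))"
      using comp_op_H2(2)[OF \<tau> g] by simp
    also have "\<dots> \<le> s ^ m * (1 / (1 - cmod (\<psi> 0))) / (1 - cmod (\<tau> 0))"
      using gn \<tau>0 by (intro divide_right_mono) auto
    finally show "h2_norm (\<lambda>z. comp_op \<phi> f z - R f z) \<le> C * s ^ m"
      by (simp add: C_def mult.commute)
  qed
qed

section \<open>Approximation numbers from below\<close>

text \<open>Gaussian elimination by induction on the equations \<open>B\<close>; the unknowns are
  indexed by \<open>K\<close>.\<close>

lemma homogeneous_system_nontrivial: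
  fixes c :: "'k \<Rightarrow> 'b \<Rightarrow> 'f::field"
  assumes "finite B" "finite K" "card B < card K"
  shows "\<exists>x. (\<exists>k\<in>K. x k \<noteq> 0) \<and> (\<forall>b\<in>B. (\<Sum>k\<in>K. x k * c k b) = 0)"
  using assms
proof (induction B arbitrary: K c rule: finite_induct)
  case empty
  then obtain k where "k \<in> K" by fastforce
  thus ?case by (intro exI[of _ "\<lambda>_. 1"]) auto
next
  case (insert b B)
  show ?case
  proof (cases "\<forall>k\<in>K. c k b = 0")
    case True
    obtain x where "\<exists>k\<in>K. x k \<noteq> 0" "\<forall>b\<in>B. (\<Sum>k\<in>K. x k * c k b) = 0"
      using insert.IH[of K c] insert.prems insert.hyps by auto
    thus ?thesis using True by (intro exI[of _ x]) auto
  next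
    case False
    then obtain k0 where k0: "k0 \<in> K" "c k0 b \<noteq> 0" by blast
    define c' where "c' = (\<lambda>k b'. c k b' - c k0 b' * c k b / c k0 b)"
    obtain x where x: "\<exists>k\<in>K - {k0}. x k \<noteq> 0" "\<forall>b\<in>B. (\<Sum>k\<in>K - {k0}. x k * c' k b) = 0"
      using insert.IH[of "K - {k0}" c'] insert.prems insert.hyps k0 by (auto simp: less_diff_conv)
    \<comment> \<open>The pivot unknown is determined by equation \<open>b\<close>; substituting it
      into the other equations yields the reduced system with coefficients
      \<open>c'\<close>.\<close>
    define y where "y = x(k0 := - (\<Sum>k\<in>K - {k0}. x k * c k b) / c k0 b)"
    have split: "(\<Sum>k\<in>K. y k * c k b') = y k0 * c k0 b' + (\<Sum>k\<in>K - {k0}. x k * c k b')" for b'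
      using k0 insert.prems by (subst sum.remove[of K k0]) (auto simp: y_def intro!: sum.cong)
    have "(\<Sum>k\<in>K. y k * c k b) = 0" unfolding split using k0 by (simp add: y_def)
    moreover have "(\<Sum>k\<in>K. y k * c k b') = 0" if "b' \<in> B" for b'
    proof -
      have "(\<Sum>k\<in>K. y k * c k b') = (\<Sum>k\<in>K - {k0}. x k * c' k b')"
        unfolding split by (simp add: y_def c'_def right_diff_distrib sum_subtractf
            sum_distrib_left sum_distrib_right sum_divide_distrib mult_ac)
      thus ?thesis using x that by simp
    qed
    moreover have "\<exists>k\<in>K. y k \<noteq> 0" using x(1) by (auto simp: y_def)
    ultimately show ?thesis by blast
  qed
qed

lemma h2_linear_op_sum:
  assumes "h2_linear_op R" "finite A" "\<And>k. k \<in> A \<Longrightarrow> f k \<in> H2"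
  shows "R (\<lambda>z. \<Sum>k\<in>A. c k * f k z) = (\<lambda>z. \<Sum>k\<in>A. c k * R (f k) z)"
  using assms(2,3)
proof (induction A rule: finite_induct)
  case empty
  have "\<forall>f\<in>H2. \<forall>c. R (\<lambda>z. c * f z) = (\<lambda>z. c * R f z)"
    using assms(1) by (simp add: h2_linear_op_def)
  from this[rule_format, OF H2_zero, of 0] show ?case by simp
next
  case (insert k A)
  have "R (\<lambda>z. c k * f k z + (\<Sum>k\<in>A. c k * f k z)) = (\<lambda>z. R (\<lambda>z. c k * f k z) z + R (\<lambda>z. \<Sum>k\<in>A. c k * f k z) z)"
  proof -
    have "\<forall>f\<in>H2. \<forall>g\<in>H2. R (\<lambda>z. f z + g z) = (\<lambda>z. R f z + R g z)"
      using assms(1) by (simp add: h2_linear_op_def)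
    from this[rule_format, of "\<lambda>z. c k * f k z" "\<lambda>z. \<Sum>k\<in>A. c k * f k z"] show ?thesis
      using insert.prems by (simp add: H2_sum H2_cmult)
  qed
  moreover have "R (\<lambda>z. c k * f k z) = (\<lambda>z. c k * R (f k) z)"
    using assms(1) insert.prems unfolding h2_linear_op_def by auto
  ultimately show ?case using insert by simp
qed

text \<open>Every competitor \<open>R\<close> of rank at most \<open>m\<close> kills the
  \<theta>-composite of some nonzero polynomial \<open>P\<close> of degree at most \<open>m\<close>.
  Composing further with \<phi> and \<sigma> turns \<open>P\<close> into P(s z), whose coefficients
  have shrunk by a factor no smaller than s^m. So the operator minus \<open>R\<close> is at least
  s^m / (C1 C2) on a unit-ball function.\<close>

proposition approx_num_comp_op_ge:
  fixes s :: real
  assumes \<phi>: "\<phi> holomorphic_on unit_disk" "\<phi> ` unit_disk \<subseteq> unit_disk"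
    and \<sigma>: "\<sigma> holomorphic_on unit_disk" "\<sigma> ` unit_disk \<subseteq> unit_disk"
    and \<theta>: "\<theta> holomorphic_on unit_disk" "\<theta> ` unit_disk \<subseteq> unit_disk"
    and s: "0 < s" "s \<le> 1"
    and eq: "\<And>z. z \<in> unit_disk \<Longrightarrow> \<theta> (\<phi> (\<sigma> z)) = of_real s * z"
  obtains C where "0 < C" "\<And>m. ereal (s ^ m) \<le> ereal C * approx_num_ext (comp_op \<phi>) (Suc m)"
proof
  define C1 where "C1 = 1 / (1 - cmod (\<theta> 0))"
  define C2 where "C2 = 1 / (1 - cmod (\<sigma> 0))"
  have "cmod (\<theta> 0) < 1" using \<theta>(2) by force
  moreover have "cmod (\<sigma> 0) < 1" using \<sigma>(2) by force
  ultimately have C: "0 < C1" "0 < C2" by (auto simp: C1_def C2_def)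
  show "0 < C1 * C2" using C by simp
  fix m :: nat
  have "ereal (s ^ m / (C1 * C2)) \<le> approx_num_ext (comp_op \<phi>) (Suc m)"
    unfolding approx_num_ext_def
  proof (intro INF_greatest)
    fix R assume "R \<in> {R. h2_linear_op R \<and> rank_less R (Suc m)}"
    hence lin: "h2_linear_op R" and "rank_less R (Suc m)" by auto
    then obtain B where B: "finite B" "card B < Suc m" "\<forall>f\<in>H2. \<exists>c. R f = (\<lambda>z. \<Sum>b\<in>B. c b * b z)"
      by (auto simp: rank_less_def)
    define v where "v = (\<lambda>k. comp_op \<theta> (disk_monomial k))"
    have v: "v k \<in> H2" for k unfolding v_def by (intro comp_op_H2 \<theta> disk_monomial_H2)
    have "\<exists>c. \<forall>k. R (v k) = (\<lambda>z. \<Sum>b\<in>B. c k b * b z)" using B(3) v by (intro choice) auto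
    then obtain c where c: "\<And>k. R (v k) = (\<lambda>z. \<Sum>b\<in>B. c k b * b z)" by blast
    \<comment> \<open>There are \<open>m + 1\<close> unknowns and at most \<open>m\<close>
      equations. The chosen coordinates \<open>c k b\<close> are annihilated, which covers a
      linearly dependent \<open>B\<close> as well.\<close>
    obtain x where x: "\<exists>k\<in>{..m}. x k \<noteq> 0" "\<forall>b\<in>B. (\<Sum>k\<le>m. x k * c k b) = 0"
      using homogeneous_system_nontrivial[of B "{..m}" c] B by auto
    define Q where "Q = (\<Sum>k\<le>m. (cmod (x k))\<^sup>2)"
    have Q: "0 < Q" unfolding Q_def proof -
      obtain k where "k \<le> m" "x k \<noteq> 0" using x(1) by auto
      thus "0 < (\<Sum>k\<le>m. (cmod (x k))\<^sup>2)" by (intro sum_pos2[of _ k]) auto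
    qed
    \<comment> \<open>The scaling makes \<open>P\<close> of norm \<open>1 / C1\<close>, so that its
      composite with \<theta> lies in the unit ball.\<close>
    define y where "y = (\<lambda>k. x k / of_real (C1 * sqrt Q))"
    have ynorm: "(\<Sum>k\<le>m. (cmod (y k))\<^sup>2) = (1 / C1)\<^sup>2"
    proof -
      have "(\<Sum>k\<le>m. (cmod (y k))\<^sup>2) = Q / (C1\<^sup>2 * Q)"
        using Q C by (simp add: y_def norm_divide norm_mult power_divide power_mult_distrib Q_def[symmetric]
              flip: sum_divide_distrib)
      thus ?thesis using Q by (simp add: power_divide)
    qed
    define P where "P = (\<lambda>z. \<Sum>k<Suc m. y k * disk_monomial k z)"
    have P: "P \<in> H2" unfolding P_def by (rule disk_polynomial_H2)
    have Pc: "taylor_coeff P k = (if k < Suc m then y k else 0)" for k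
      unfolding P_def by (rule taylor_coeff_disk_polynomial)
    have Pn: "h2_norm P = 1 / C1"
    proof -
      have "(\<Sum>n. (cmod (taylor_coeff P n))\<^sup>2) = (\<Sum>n\<le>m. (cmod (taylor_coeff P n))\<^sup>2)"
        by (rule suminf_finite) (auto simp: Pc)
      also have "\<dots> = (1 / C1)\<^sup>2" unfolding ynorm[symmetric] by (auto simp: Pc)
      finally show ?thesis using C by (simp add: h2_norm_def)
    qed
    define F where "F = comp_op \<theta> P"
    have F: "F \<in> H2" "h2_norm F \<le> 1"
    proof -
      show "F \<in> H2" unfolding F_def by (intro comp_op_H2 \<theta> P)
      have "h2_norm F \<le> C1 * h2_norm P" using comp_op_H2(2)[OF \<theta> P] by (simp add: F_def C1_def)
      thus "h2_norm F \<le> 1" using C by (simp add: Pn)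
    qed
    have F_eq: "F = (\<lambda>z. \<Sum>k\<le>m. y k * v k z)"
      unfolding F_def P_def comp_op_sum v_def by (simp add: lessThan_Suc_atMost)
    have RF: "R F z = 0" for z
    proof -
      have "R F z = (\<Sum>k\<le>m. \<Sum>b\<in>B. y k * c k b * b z)"
        unfolding F_eq by (subst h2_linear_op_sum[OF lin]) (auto simp: v c sum_distrib_left mult_ac)
      also have "\<dots> = (\<Sum>b\<in>B. (\<Sum>k\<le>m. x k * c k b) * b z / of_real (C1 * sqrt Q))"
        by (subst sum.swap) (simp add: y_def sum_distrib_left sum_distrib_right sum_divide_distrib mult_ac)
      also have "\<dots> = 0" using x(2) by simp
      finally show ?thesis .
    qed
    have H: "comp_op \<phi> F \<in> H2" by (intro comp_op_H2 \<phi> F)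
    define E where "E = comp_op \<sigma> (comp_op \<phi> F)"
    have E: "E \<in> H2" unfolding E_def by (intro comp_op_H2 \<sigma> H)
    have Ec: "taylor_coeff E k = s ^ k * taylor_coeff P k" for k
    proof -
      have "taylor_coeff E k = taylor_coeff (\<lambda>z. P (of_real s * z)) k"
      proof (rule taylor_coeff_cong)
        fix z assume z: "z \<in> unit_disk"
        hence "\<sigma> z \<in> unit_disk" "\<phi> (\<sigma> z) \<in> unit_disk" using \<sigma>(2) \<phi>(2) by blast+
        thus "E z = P (of_real s * z)" using z eq[OF z] by (simp add: E_def F_def comp_op_def)
      qed
      thus ?thesis using s H2_holomorphic[OF P] by (simp add: taylor_coeff_scale)
    qed
    have "(s ^ m * (1 / C1))\<^sup>2 \<le> (h2_norm E)\<^sup>2"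
    proof -
      have "(s ^ m * (1 / C1))\<^sup>2 = (\<Sum>k\<le>m. (s ^ m)\<^sup>2 * (cmod (y k))\<^sup>2)"
        unfolding power_mult_distrib ynorm[symmetric] by (simp add: sum_distrib_left)
      also have "\<dots> \<le> (\<Sum>k\<le>m. (cmod (taylor_coeff E k))\<^sup>2)"
        using s by (intro sum_mono)
          (auto simp: Ec Pc norm_mult norm_power power_mult_distrib intro!: mult_right_mono power_mono power_decreasing)
      also have "\<dots> \<le> (h2_norm E)\<^sup>2"
        unfolding h2_norm_sq[OF E] by (intro sum_le_suminf H2_summable E) auto
      finally show ?thesis .
    qed
    hence "s ^ m * (1 / C1) \<le> h2_norm E"
      using h2_norm_nonneg[OF E] by (rule power2_le_imp_le)
    also have "h2_norm E \<le> C2 * h2_norm (comp_op \<phi> F)"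
      using comp_op_H2(2)[OF \<sigma> H] by (simp add: E_def C2_def)
    finally have "s ^ m / (C1 * C2) \<le> h2_norm (comp_op \<phi> F)"
      using C by (simp add: field_simps)
    also have "comp_op \<phi> F = (\<lambda>z. comp_op \<phi> F z - R F z)" by (simp add: RF)
    finally have "ereal (s ^ m / (C1 * C2)) \<le> ereal (h2_norm (\<lambda>z. comp_op \<phi> F z - R F z))" by simp
    also have "\<dots> \<le> h2_opnorm (\<lambda>f z. comp_op \<phi> f z - R f z)"
      unfolding h2_opnorm_def using F by (intro SUP_upper) auto
    finally show "ereal (s ^ m / (C1 * C2)) \<le> h2_opnorm (\<lambda>f z. comp_op \<phi> f z - R f z)" .
  qed
  hence "ereal (C1 * C2) * ereal (s ^ m / (C1 * C2)) \<le> ereal (C1 * C2) * approx_num_ext (comp_op \<phi>) (Suc m)"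
    using C by (intro ereal_mult_left_mono) auto
  thus "ereal (s ^ m) \<le> ereal (C1 * C2) * approx_num_ext (comp_op \<phi>) (Suc m)" using C by simp
qed

section \<open>Lower bound for the Green energy\<close>

lemma one_minus_cnj_mult_nonzero:
  assumes "cmod w \<le> 1" "cmod z < 1"
  shows "1 - cnj w * z \<noteq> 0"
proof
  assume "1 - cnj w * z = 0"
  hence "cmod (cnj w * z) = 1" by simp
  hence "cmod w * cmod z = 1" by (simp add: norm_mult)
  moreover have "cmod w * cmod z \<le> cmod z" using assms by (simp add: mult_left_le_one_le)
  ultimately show False using assms by simp
qed

text \<open>The automorphism (z - p) / (1 - cnj p z), with inverse
  \<open>disk_moebius (- p)\<close>. Its modulus is the pseudohyperbolic distance from
  \<open>p\<close> to \<open>z\<close>.\<close>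

abbreviation disk_moebius :: "complex \<Rightarrow> complex \<Rightarrow> complex" where
  "disk_moebius \<equiv> Moebius_function 0"

lemma moebius_in_disk: "cmod p < 1 \<Longrightarrow> cmod z < 1 \<Longrightarrow> cmod (disk_moebius p z) < 1"
  by (rule Moebius_function_norm_lt_1)

text \<open>Numerator and denominator of the kernel acquire the factors D / (A cnj B) and D / (A B),
  which have equal modulus.\<close>

lemma green_moebius:
  assumes "cmod p < 1" "cmod z < 1" "cmod w < 1"
  shows "green (disk_moebius p z) (disk_moebius p w) = green z w"
proof -
  define A B D where "A = 1 - cnj p * z" and "B = 1 - cnj p * w" and "D = 1 - cnj p * p"
  have nz: "A \<noteq> 0" "B \<noteq> 0" "D \<noteq> 0"
    using assms one_minus_cnj_mult_nonzero[of p] by (auto simp: A_def B_def D_def)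
  have cB: "cnj B = 1 - p * cnj w" by (simp add: B_def)
  have cBnz: "1 - p * cnj w \<noteq> 0" using nz(2) cB by (metis complex_cnj_zero_iff)
  have diff: "disk_moebius p z - disk_moebius p w = (z - w) * D / (A * B)"
    using nz unfolding Moebius_function_simple A_def B_def D_def
    by (simp add: divide_simps) (simp add: algebra_simps)
  have one: "1 - cnj (disk_moebius p w) * disk_moebius p z = (1 - cnj w * z) * D / (A * cnj B)"
    using nz cBnz unfolding Moebius_function_simple cB A_def D_def
    by (simp add: divide_simps) (simp add: algebra_simps)
  have "disk_moebius p z = disk_moebius p w \<longleftrightarrow> z = w"
    using diff nz by (metis divide_eq_0_iff mult_eq_0_iff right_minus_eq)
  moreover have "cmod ((1 - cnj (disk_moebius p w) * disk_moebius p z) / (disk_moebius p z - disk_moebius p w))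
      = cmod ((1 - cnj w * z) / (z - w))"
    unfolding diff one using nz by (simp add: norm_divide norm_mult)
  ultimately show ?thesis by (simp add: green_def)
qed

text \<open>The squares differ by (1 - |z|^2)(1 - |w|^2). This gives both the nonnegativity of the
  Green kernel and the comparison of the rescaled kernel with a power series.\<close>

lemma norm_one_minus_cnj_mult_ge:
  assumes "cmod z \<le> 1" "cmod w \<le> 1"
  shows "cmod (z - w) \<le> cmod (1 - cnj w * z)"
proof -
  have "(cmod (1 - cnj w * z))\<^sup>2 - (cmod (z - w))\<^sup>2 = (1 - (cmod z)\<^sup>2) * (1 - (cmod w)\<^sup>2)"
    unfolding cmod_power2 by (simp add: power2_eq_square algebra_simps)
  moreover have "\<dots> \<ge> 0" using assms by (simp add: power_le_one)
  ultimately have "(cmod (z - w))\<^sup>2 \<le> (cmod (1 - cnj w * z))\<^sup>2" by linarith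
  thus ?thesis by (rule power2_le_imp_le) simp
qed

text \<open>The logarithm is the real part of the series with coefficients (1 - \<sigma>^n) / n, and
  the tail is dominated by a geometric series. Nonnegative coefficients make each partial sum
  positive definite once \<open>x\<close> is a product u(z) cnj (u(w)). The term at
  \<open>n = 0\<close> is 0, by division by zero.\<close>

lemma ln_quotient_kernel_ge:
  fixes x :: complex and \<sigma> q :: real
  assumes x: "cmod x \<le> q" "q < 1" and \<sigma>: "0 \<le> \<sigma>" "\<sigma> \<le> 1"
  shows "Re (\<Sum>n<m. of_real ((1 - \<sigma> ^ n) / n) * x ^ n) - q ^ m / (1 - q)
           \<le> ln (cmod ((1 - of_real \<sigma> * x) / (1 - x)))"
proof -
  have q0: "0 \<le> q" using x(1) norm_ge_zero[of x] by linarith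
  define t where "t = (\<lambda>n. of_real ((1 - \<sigma> ^ n) / n) * x ^ n :: complex)"
  have sx: "cmod (of_real \<sigma> * x) < 1"
    using mult_left_le_one_le[of "cmod x" \<sigma>] \<sigma> x by (simp add: norm_mult)
  have "(\<lambda>n. - ((- (- (of_real \<sigma> * x))) ^ n) / of_nat n - - ((- (- x)) ^ n) / of_nat n) sums
     (ln (1 + - (of_real \<sigma> * x)) - ln (1 + - x))"
    by (intro sums_diff Ln_series') (use sx x in auto)
  moreover have "(\<lambda>n. - ((- (- (of_real \<sigma> * x))) ^ n) / of_nat n - - ((- (- x)) ^ n) / of_nat n) = t"
    by (auto simp: t_def fun_eq_iff diff_divide_distrib power_mult_distrib algebra_simps)
  ultimately have t_sums: "t sums (ln (1 - of_real \<sigma> * x) - ln (1 - x))" by simp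
  have nz: "1 - of_real \<sigma> * x \<noteq> 0" "1 - x \<noteq> 0" using sx x by auto
  have "ln (cmod ((1 - of_real \<sigma> * x) / (1 - x))) = Re (ln (1 - of_real \<sigma> * x) - ln (1 - x))"
    using nz by (simp add: norm_divide ln_div)
  also have "\<dots> = Re (suminf t)" using t_sums by (simp add: sums_iff)
  also have "suminf t = (\<Sum>n. t (n + m)) + (\<Sum>n<m. t n)"
    using t_sums by (intro suminf_split_initial_segment) (simp add: sums_iff)
  finally have eq: "ln (cmod ((1 - of_real \<sigma> * x) / (1 - x))) = Re (\<Sum>n. t (n + m)) + Re (\<Sum>n<m. t n)"
    by simp
  have tb: "cmod (t n) \<le> q ^ n" for n
  proof -
    have "\<sigma> ^ n \<le> 1" "0 \<le> \<sigma> ^ n" using \<sigma> by (auto simp: power_le_one)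
    hence "\<bar>(1 - \<sigma> ^ n) / real n\<bar> \<le> 1" by (cases n) (auto simp: field_simps)
    hence "cmod (t n) \<le> 1 * q ^ n"
      unfolding t_def norm_mult norm_of_real norm_power using x by (intro mult_mono power_mono) auto
    thus ?thesis by simp
  qed
  have geo: "(\<lambda>n. q ^ m * q ^ n) sums (q ^ m * (1 / (1 - q)))"
    using q0 x by (intro sums_mult geometric_sums) auto
  have "cmod (\<Sum>n. t (n + m)) \<le> (\<Sum>n. q ^ m * q ^ n)"
    by (intro norm_suminf_le) (use tb[of "_ + m"] geo in \<open>auto simp: power_add mult.commute sums_iff\<close>)
  hence "- (q ^ m / (1 - q)) \<le> Re (\<Sum>n. t (n + m))"
    using geo abs_Re_le_cmod[of "\<Sum>n. t (n + m)"] by (simp add: sums_iff)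
  thus ?thesis using eq by (simp add: t_def)
qed

text \<open>\<open>ennreal\<close> clips negative values to 0, which can only raise the integral. It
  lets a signed integrable minorant be compared with the Green kernel, whose integral may be
  infinite.\<close>

lemma ennreal_integral_le_nn_integral:
  fixes f :: "'a \<Rightarrow> real"
  assumes "integrable M f"
  shows "ennreal (\<integral>x. f x \<partial>M) \<le> (\<integral>\<^sup>+x. ennreal (f x) \<partial>M)"
proof -
  have "ennreal (\<integral>x. f x \<partial>M) \<le> ennreal (\<integral>x. max 0 (f x) \<partial>M)"
    using assms by (intro ennreal_leI integral_mono) auto
  also have "\<dots> = (\<integral>\<^sup>+x. ennreal (max 0 (f x)) \<partial>M)"
    using assms by (intro nn_integral_eq_integral[symmetric]) auto
  finally show ?thesis by simp
qed

text \<open>Dividing the automorphism by s' > s gives |u| <= s / s' < 1 on the support. The Green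
  kernel is then at least ln (1 / s') plus the logarithmic kernel with \<sigma> = s'^2 at x = cnj (u
  w) u z, and |x| <= (s / s')^2 keeps the truncation error uniform. With s' = s this bound on |x|
  would be 1 and the geometric tail would diverge.\<close>

lemma green_energy_ge_aux:
  fixes s s' :: real
  assumes \<mu>: "\<mu> \<in> admissible_measures E" and p: "cmod p < 1"
    and E: "\<And>z. z \<in> E \<Longrightarrow> cmod z < 1 \<Longrightarrow> cmod (disk_moebius p z) \<le> s"
    and s: "0 < s" "s < s'" "s' < 1"
  shows "ennreal (ln (1 / s') - ((s / s')\<^sup>2) ^ m / (1 - (s / s')\<^sup>2)) \<le> green_energy \<mu>"
proof -
  obtain L where L: "compact L" "L \<subseteq> E \<inter> unit_disk" "emeasure \<mu> (UNIV - L) = 0"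
    and sets_\<mu>[measurable_cong]: "sets \<mu> = sets borel" and "prob_space \<mu>"
    using \<mu> by (auto simp: admissible_measures_def)
  interpret prob_space \<mu> by fact
  have AE_L: "AE z in \<mu>. z \<in> L"
    using L by (intro AE_I[of _ _ "UNIV - L"]) (auto intro: borel_closed compact_imp_closed simp: sets_\<mu>)
  define q where "q = (s / s')\<^sup>2"
  have q: "q < 1" using s by (auto simp: q_def power2_eq_square field_simps intro!: mult_strict_mono)
  define u where "u = (\<lambda>z. disk_moebius p z / of_real s')"
  have u_meas [measurable]: "u \<in> borel_measurable \<mu>"
    unfolding u_def Moebius_function_simple by measurable
  have uL: "cmod (u z) \<le> s / s'" if "z \<in> L" for z
  proof -
    have "cmod (disk_moebius p z) \<le> s" using that L(2) by (intro E) auto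
    thus ?thesis using s by (simp add: u_def norm_divide divide_right_mono)
  qed
  have ss: "s / s' < 1" using s by simp
  have u1: "cmod (u z) \<le> 1" if "z \<in> L" for z
    using uL[OF that] ss by simp
  have int: "integrable \<mu> (\<lambda>z. u z ^ n)" for n
  proof (rule integrable_const_bound[of _ 1])
    show "AE z in \<mu>. norm (u z ^ n) \<le> 1"
      using AE_L by eventually_elim (auto simp: norm_power u1 power_le_one)
  qed measurable
  define A where "A = ln (1 / s') - q ^ m / (1 - q)"
  define c where "c = (\<lambda>n::nat. (1 - (s'\<^sup>2) ^ n) / n)"
  have c0: "0 \<le> c n" for n using s by (auto simp: c_def power_le_one)
  \<comment> \<open>\<open>A\<close> holds the constant and the truncation error; the remaining
    terms are rank-one kernels with weights \<open>c n\<close> >= 0.\<close>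
  define k where "k = (\<lambda>z w. A + Re (\<Sum>n<m. of_real (c n) * (u z ^ n * cnj (u w ^ n))))"
  have green_ge: "ennreal (k z w) \<le> green z w" if z: "z \<in> L" and w: "w \<in> L" for z w
  proof (cases "z = w")
    case True thus ?thesis by (simp add: green_def)
  next
    case False
    have zw: "cmod z < 1" "cmod w < 1" using z w L(2) by auto
    have "cmod (cnj (u w) * u z) \<le> (s / s') * (s / s')"
      unfolding norm_mult complex_mod_cnj using uL[OF z] uL[OF w] by (intro mult_mono) (use s in auto)
    hence x: "cmod (cnj (u w) * u z) \<le> q" by (simp add: q_def power2_eq_square)
    have "k z w = ln (1 / s') + (Re (\<Sum>n<m. of_real ((1 - (s'\<^sup>2) ^ n) / n) * (cnj (u w) * u z) ^ n) - q ^ m / (1 - q))"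
      by (simp add: k_def A_def c_def power_mult_distrib mult_ac)
    also have "\<dots> \<le> ln (1 / s') + ln (cmod ((1 - of_real (s'\<^sup>2) * (cnj (u w) * u z)) / (1 - cnj (u w) * u z)))"
      using ln_quotient_kernel_ge[OF x q, of "s'\<^sup>2" m] s by (auto simp: power_le_one)
    also have "\<dots> \<le> ln (cmod ((1 - cnj (disk_moebius p w) * disk_moebius p z) / (disk_moebius p z - disk_moebius p w)))"
    proof -
      have mz: "disk_moebius p z = of_real s' * u z" "disk_moebius p w = of_real s' * u w"
        using s by (auto simp: u_def)
      have "disk_moebius p z \<noteq> disk_moebius p w"
        using False p zw by (metis Moebius_function_compose minus_minus norm_minus_cancel)
      hence uu: "u z \<noteq> u w" using mz by auto
      have lt: "cmod (u z) < 1" using uL[OF z] ss by simp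
      have d: "1 - cnj (u w) * u z \<noteq> 0"
        by (rule one_minus_cnj_mult_nonzero[OF u1[OF w] lt])
      have n: "1 - of_real (s'\<^sup>2) * (cnj (u w) * u z) \<noteq> 0"
      proof -
        have "cmod (of_real s' * u w) \<le> 1" "cmod (of_real s' * u z) < 1"
          using moebius_in_disk[OF p zw(1)] moebius_in_disk[OF p zw(2)] mz by auto
        from one_minus_cnj_mult_nonzero[OF this] show ?thesis by (simp add: power2_eq_square mult_ac)
      qed
      \<comment> \<open>Since |u| <= 1, |u z - u w| is at most |1 - cnj (u w) u z|. This replacement
        is the only loss, and it leaves a function of the single product cnj (u w) u z.\<close>
      have "ln (1 / s') + ln (cmod ((1 - of_real (s'\<^sup>2) * (cnj (u w) * u z)) / (1 - cnj (u w) * u z)))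
          \<le> ln (1 / s') + ln (cmod (1 - of_real (s'\<^sup>2) * (cnj (u w) * u z)) / cmod (u z - u w))"
        unfolding norm_divide using n d uu
        by (intro add_left_mono ln_mono divide_left_mono norm_one_minus_cnj_mult_ge u1 z w) auto
      also have "\<dots> = ln (1 / s' * (cmod (1 - of_real (s'\<^sup>2) * (cnj (u w) * u z)) / cmod (u z - u w)))"
        using n uu s by (subst ln_mult) auto
      also have "1 / s' * (cmod (1 - of_real (s'\<^sup>2) * (cnj (u w) * u z)) / cmod (u z - u w))
          = cmod ((1 - cnj (disk_moebius p w) * disk_moebius p z) / (disk_moebius p z - disk_moebius p w))"
        unfolding mz using s by (simp add: norm_divide norm_mult power2_eq_square mult_ac flip: right_diff_distrib)
      finally show ?thesis .
    qed
    finally have "ennreal (k z w) \<le> green (disk_moebius p z) (disk_moebius p w)"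
      by (auto simp: green_def intro: ennreal_leI)
    thus ?thesis using green_moebius[OF p zw] by simp
  qed
  have integral_Re: "(\<integral>w. A + Re (g w) \<partial>\<mu>) = A + Re (\<integral>w. g w \<partial>\<mu>)"
    and integrable_Re: "integrable \<mu> (\<lambda>w. A + Re (g w))" if "integrable \<mu> g" for g :: "complex \<Rightarrow> complex"
  proof -
    have i: "integrable \<mu> (\<lambda>w. Re (g w))" using that by (rule integrable_bounded_linear[OF bounded_linear_Re])
    show "integrable \<mu> (\<lambda>w. A + Re (g w))" using i by simp
    show "(\<integral>w. A + Re (g w) \<partial>\<mu>) = A + Re (\<integral>w. g w \<partial>\<mu>)"
      using i integral_bounded_linear[OF bounded_linear_Re that] by (simp add: prob_space)
  qed
  define M where "M = (\<lambda>n. \<integral>z. u z ^ n \<partial>\<mu>)"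
  have inner: "(\<integral>w. k z w \<partial>\<mu>) = A + Re (\<Sum>n<m. of_real (c n) * (u z ^ n * cnj (M n)))"
    and int_inner: "integrable \<mu> (k z)" for z
  proof -
    have "integrable \<mu> (\<lambda>w. \<Sum>n<m. of_real (c n) * (u z ^ n * cnj (u w ^ n)))"
      by (intro Bochner_Integration.integrable_sum integrable_mult_right integrable_cnj int)
    note i = integral_Re[OF this] integrable_Re[OF this]
    show "integrable \<mu> (k z)" unfolding k_def by (rule i)
    have "(\<integral>w. k z w \<partial>\<mu>) = A + Re (\<integral>w. (\<Sum>n<m. of_real (c n) * (u z ^ n * cnj (u w ^ n))) \<partial>\<mu>)"
      unfolding k_def by (rule i)
    also have "(\<integral>w. (\<Sum>n<m. of_real (c n) * (u z ^ n * cnj (u w ^ n))) \<partial>\<mu>)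
        = (\<Sum>n<m. of_real (c n) * (u z ^ n * cnj (M n)))"
      unfolding M_def
      by (subst Bochner_Integration.integral_sum)
         (use int in \<open>auto intro!: integrable_mult_right integrable_cnj simp del: complex_cnj_power\<close>)
    finally show "(\<integral>w. k z w \<partial>\<mu>) = A + Re (\<Sum>n<m. of_real (c n) * (u z ^ n * cnj (M n)))" .
  qed
  have outer: "A \<le> (\<integral>z. (\<integral>w. k z w \<partial>\<mu>) \<partial>\<mu>)" and int_outer: "integrable \<mu> (\<lambda>z. \<integral>w. k z w \<partial>\<mu>)"
  proof -
    have "integrable \<mu> (\<lambda>z. \<Sum>n<m. of_real (c n) * (u z ^ n * cnj (M n)))"
      by (intro Bochner_Integration.integrable_sum integrable_mult_right integrable_mult_left int)
    note i = integral_Re[OF this] integrable_Re[OF this]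
    show "integrable \<mu> (\<lambda>z. \<integral>w. k z w \<partial>\<mu>)" unfolding inner by (rule i)
    have "(\<integral>z. (\<integral>w. k z w \<partial>\<mu>) \<partial>\<mu>) = A + Re (\<integral>z. (\<Sum>n<m. of_real (c n) * (u z ^ n * cnj (M n))) \<partial>\<mu>)"
      unfolding inner by (rule i)
    also have "(\<integral>z. (\<Sum>n<m. of_real (c n) * (u z ^ n * cnj (M n))) \<partial>\<mu>)
        = (\<Sum>n<m. of_real (c n) * (M n * cnj (M n)))"
      unfolding M_def
      by (subst Bochner_Integration.integral_sum)
         (use int in \<open>auto intro!: integrable_mult_right integrable_mult_left\<close>)
    \<comment> \<open>Positive definiteness: the double integral is a weighted sum of squared
      moments, so \<open>A\<close> alone is a lower bound.\<close>
    also have "Re \<dots> = (\<Sum>n<m. c n * (cmod (M n))\<^sup>2)"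
      by (simp flip: complex_norm_square)
    also have "A \<le> A + \<dots>" using c0 by (simp add: sum_nonneg)
    finally show "A \<le> (\<integral>z. (\<integral>w. k z w \<partial>\<mu>) \<partial>\<mu>)" by simp
  qed
  have "ennreal A \<le> ennreal (\<integral>z. (\<integral>w. k z w \<partial>\<mu>) \<partial>\<mu>)" by (intro ennreal_leI outer)
  also have "\<dots> \<le> (\<integral>\<^sup>+z. ennreal (\<integral>w. k z w \<partial>\<mu>) \<partial>\<mu>)"
    by (rule ennreal_integral_le_nn_integral[OF int_outer])
  also have "\<dots> \<le> (\<integral>\<^sup>+z. (\<integral>\<^sup>+w. green z w \<partial>\<mu>) \<partial>\<mu>)"
  proof (rule nn_integral_mono_AE)
    show "AE z in \<mu>. ennreal (\<integral>w. k z w \<partial>\<mu>) \<le> (\<integral>\<^sup>+w. green z w \<partial>\<mu>)"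
      using AE_L
    proof eventually_elim
      case (elim z)
      have "ennreal (\<integral>w. k z w \<partial>\<mu>) \<le> (\<integral>\<^sup>+w. ennreal (k z w) \<partial>\<mu>)"
        by (rule ennreal_integral_le_nn_integral[OF int_inner])
      also have "\<dots> \<le> (\<integral>\<^sup>+w. green z w \<partial>\<mu>)"
      proof (rule nn_integral_mono_AE)
        show "AE w in \<mu>. ennreal (k z w) \<le> green z w"
          using AE_L by eventually_elim (rule green_ge[OF elim])
      qed
      finally show ?case .
    qed
  qed
  finally show ?thesis by (simp add: green_energy_def A_def q_def)
qed

text \<open>The truncation error vanishes as m -> infinity with s' fixed; afterwards s' decreases to
  s.\<close>

proposition green_V_ge:
  fixes s :: real
  assumes p: "cmod p < 1" and s: "0 < s" "s < 1"
    and E: "\<And>z. z \<in> E \<Longrightarrow> cmod z < 1 \<Longrightarrow> cmod (disk_moebius p z) \<le> s"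
  shows "ennreal (ln (1 / s)) \<le> green_V E"
  unfolding green_V_def
proof (rule INF_greatest)
  fix \<mu> assume \<mu>: "\<mu> \<in> admissible_measures E"
  have s': "ennreal (ln (1 / s')) \<le> green_energy \<mu>" if "s < s'" "s' < 1" for s'
  proof (rule tendsto_upperbound)
    define q where "q = (s / s')\<^sup>2"
    have "q < 1" "0 \<le> q" using that s by (auto simp: q_def power2_eq_square field_simps intro!: mult_strict_mono)
    hence "(\<lambda>m. ln (1 / s') - q ^ m / (1 - q)) \<longlonglongrightarrow> ln (1 / s') - 0 / (1 - q)"
      by (intro tendsto_intros LIMSEQ_power_zero) auto
    thus "(\<lambda>m. ennreal (ln (1 / s') - q ^ m / (1 - q))) \<longlonglongrightarrow> ennreal (ln (1 / s'))"
      by (intro tendsto_ennrealI) simp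
    show "\<forall>\<^sub>F m in sequentially. ennreal (ln (1 / s') - q ^ m / (1 - q)) \<le> green_energy \<mu>"
      unfolding q_def by (intro always_eventually allI green_energy_ge_aux[OF \<mu> p E s(1) that])
  qed simp
  show "ennreal (ln (1 / s)) \<le> green_energy \<mu>"
  proof (rule tendsto_upperbound)
    show "((\<lambda>s'. ennreal (ln (1 / s'))) \<longlongrightarrow> ennreal (ln (1 / s))) (at_right s)"
      using s by (intro tendsto_ennrealI tendsto_intros) auto
    show "\<forall>\<^sub>F s' in at_right s. ennreal (ln (1 / s')) \<le> green_energy \<mu>"
      using s s' by (intro eventually_at_rightI[of s 1]) auto
  qed simp
qed

section \<open>Upper bound for the Green energy\<close>

lemma green_nonneg_ln:
  assumes "cmod z < 1" "cmod w < 1" "z \<noteq> w"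
  shows "0 \<le> ln (cmod ((1 - cnj w * z) / (z - w)))"
  using norm_one_minus_cnj_mult_ge[of z w] assms
  by (intro ln_ge_zero) (simp add: norm_divide)

lemma green_measurable [measurable]: "green z \<in> borel_measurable borel"
proof -
  have [measurable]: "cnj \<in> borel_measurable borel"
    by (intro borel_measurable_continuous_onI continuous_intros)
  show ?thesis unfolding green_def by measurable
qed

lemma measurable_circ [measurable]: "circ r \<in> borel_measurable borel"
  unfolding circ_def by (intro borel_measurable_continuous_onI continuous_intros)

text \<open>For fixed z the Green kernel is harmonic in w on |w| < |z|, and ln (1 / |z|) is its
  value at w = 0.\<close>

lemma green_circ_mean:
  assumes s: "0 < s" "s < cmod z" and z: "cmod z < 1"
  shows "(\<integral>\<^sup>+t. green z (circ s t) \<partial>restrict_space lborel {0..1}) = ennreal (ln (1 / cmod z))"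
proof -
  \<comment> \<open>The disk |w| < |z| is rescaled to the unit disk, and conjugation is moved from w
    to z: this keeps the modulus and makes the quotient holomorphic. Being zero-free, it has a
    holomorphic logarithm.\<close>
  define H where "H = (\<lambda>\<zeta>. (1 - cnj z * (of_real (cmod z) * \<zeta>)) / (z - of_real (cmod z) * \<zeta>))"
  have z0: "z \<noteq> 0" using s by auto
  have nz: "z - of_real (cmod z) * \<zeta> \<noteq> 0" "1 - cnj z * (of_real (cmod z) * \<zeta>) \<noteq> 0" if "\<zeta> \<in> unit_disk" for \<zeta>
  proof -
    have "cmod (of_real (cmod z) * \<zeta>) < cmod z" using that z0 by (simp add: norm_mult)
    thus "z - of_real (cmod z) * \<zeta> \<noteq> 0" by auto
    show "1 - cnj z * (of_real (cmod z) * \<zeta>) \<noteq> 0"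
      using \<open>cmod (of_real (cmod z) * \<zeta>) < cmod z\<close> z by (intro one_minus_cnj_mult_nonzero) auto
  qed
  have Hhol: "H holomorphic_on unit_disk"
    unfolding H_def by (intro holomorphic_intros) (use nz in auto)
  have Hnz: "H \<zeta> \<noteq> 0" if "\<zeta> \<in> unit_disk" for \<zeta>
    using nz[OF that] by (simp add: H_def)
  obtain g where g: "g holomorphic_on unit_disk" "\<And>\<zeta>. \<zeta> \<in> unit_disk \<Longrightarrow> H \<zeta> = exp (g \<zeta>)"
    using contractible_imp_holomorphic_log[OF Hhol convex_imp_contractible[OF convex_ball] Hnz] by blast
  have Reg: "Re (g \<zeta>) = ln (cmod (H \<zeta>))" if "\<zeta> \<in> unit_disk" for \<zeta>
    using g(2)[OF that] by (simp add: norm_exp_eq_Re)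
  define r where "r = s / cmod z"
  have r: "0 < r" "r < 1" using s z0 by (simp_all add: r_def)
  have circ: "of_real (cmod z) * circ r t = circ s t" for t using z0 by (simp add: circ_def r_def)
  define f where "f = (\<lambda>t. ln (cmod ((1 - cnj (circ s t) * z) / (z - circ s t))))"
  have f_eq: "f t = Re (g (circ r t))" for t
  proof -
    have "1 - cnj (circ s t) * z = cnj (1 - cnj z * circ s t)" by (simp add: mult.commute)
    hence "cmod (1 - cnj (circ s t) * z) = cmod (1 - cnj z * circ s t)" by (simp only: complex_mod_cnj)
    thus ?thesis using r by (simp add: f_def Reg H_def circ norm_divide)
  qed
  have "(f has_integral Re (g 0)) {0..1}"
    using has_integral_linear[OF circ_mean_value[OF g(1) r] bounded_linear_Re]
    by (simp add: o_def f_eq[abs_def])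
  also have "Re (g 0) = ln (1 / cmod z)" using z0 by (subst Reg) (auto simp: H_def norm_divide)
  finally have "((\<lambda>t. if t \<in> {0..1} then f t else 0) has_integral ln (1 / cmod z)) UNIV"
    by (subst has_integral_restrict_UNIV)
  moreover have f0: "0 \<le> f t" for t
    unfolding f_def using s z by (intro green_nonneg_ln) auto
  moreover have [measurable]: "f \<in> borel_measurable borel"
  proof -
    have [measurable]: "cnj \<in> borel_measurable borel"
      by (intro borel_measurable_continuous_onI continuous_intros)
    show ?thesis unfolding f_def by measurable
  qed
  ultimately have *: "(\<integral>\<^sup>+t. ennreal (if t \<in> {0..1} then f t else 0) \<partial>lborel) = ennreal (ln (1 / cmod z))"
    by (intro nn_integral_has_integral_lborel) auto
  have "green z (circ s t) = ennreal (f t)" for t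
    using s by (auto simp: green_def f_def)
  hence "(\<integral>\<^sup>+t. green z (circ s t) \<partial>restrict_space lborel {0..1}) = (\<integral>\<^sup>+t. ennreal (f t) * indicator {0..1} t \<partial>lborel)"
    by (simp add: nn_integral_restrict_space)
  also have "\<dots> = (\<integral>\<^sup>+t. ennreal (if t \<in> {0..1} then f t else 0) \<partial>lborel)"
    by (intro nn_integral_cong) (auto simp: indicator_def)
  finally show ?thesis using * by simp
qed

text \<open>On the circle itself the potential has a logarithmic singularity; Fatou's lemma bounds it
  by the potentials at points approaching the circle from outside.\<close>

lemma green_circ_potential_le:
  assumes s: "0 < s" "s < 1" and z: "cmod z = s"
  shows "(\<integral>\<^sup>+t. green z (circ s t) \<partial>restrict_space lborel {0..1}) \<le> ennreal (ln (1 / s))"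
proof -
  \<comment> \<open>Half of the available relative gap: s (1 + \<eta>) is the midpoint of s and 1,
    so all points \<open>y n\<close> stay inside the disk.\<close>
  define \<eta> where "\<eta> = (1 / s - 1) / 2"
  have \<eta>: "0 < \<eta>" "s * (1 + \<eta>) < 1" using s by (auto simp: \<eta>_def field_simps)
  define e where "e = (\<lambda>n. \<eta> * inverse (real (Suc n)))"
  have e: "0 < e n" "e n \<le> \<eta>" for n using \<eta> mult_left_le[of "inverse (real (Suc n))" \<eta>]
    by (auto simp: e_def inverse_le_1_iff simp del: of_nat_Suc)
  have e0: "e \<longlonglongrightarrow> 0" unfolding e_def using tendsto_mult_right_zero[OF LIMSEQ_inverse_real_of_nat] by simp
  define y where "y = (\<lambda>n. of_real (1 + e n) * z)"
  have ny: "cmod (y n) = s * (1 + e n)" for n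
    unfolding y_def norm_mult norm_of_real z using e(1)[of n] by simp
  have y1: "s < cmod (y n)" "cmod (y n) < 1" for n
  proof -
    show "s < cmod (y n)" using s e(1)[of n] by (simp add: ny)
    have "s * (1 + e n) \<le> s * (1 + \<eta>)" using e(2)[of n] s by simp
    thus "cmod (y n) < 1" using \<eta> by (simp add: ny)
  qed
  have ylim: "y \<longlonglongrightarrow> z"
    using tendsto_mult[OF tendsto_of_real[OF tendsto_add[OF tendsto_const[of 1] e0]] tendsto_const[of z]]
    by (simp add: y_def)
  have lim: "(\<lambda>n. green (y n) (circ s t)) \<longlonglongrightarrow> green z (circ s t)" for t
  proof -
    define w where "w = circ s t"
    have w: "cmod w = s" using s by (simp add: w_def)
    have yw: "y n \<noteq> w" for n using y1(1)[of n] w by auto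
    have nz: "1 - cnj w * z \<noteq> 0" using w z s by (intro one_minus_cnj_mult_nonzero) auto
    have "(\<lambda>n. ennreal (ln (cmod ((1 - cnj w * y n) / (y n - w))))) \<longlonglongrightarrow> green z w"
    proof (cases "z = w")
      case False
      thus ?thesis using nz
        by (auto simp: green_def intro!: tendsto_ennrealI tendsto_intros ylim)
    next
      \<comment> \<open>At the singular point the kernels tend to infinity, which is the value
        \<open>green z z\<close>; so the pointwise limit holds for every \<open>t\<close>.\<close>
      case True
      have 1: "(\<lambda>n. cmod (1 - cnj w * y n)) \<longlonglongrightarrow> cmod (1 - cnj w * z)"
        by (intro tendsto_intros ylim)
      have 2: "(\<lambda>n. cmod (y n - w)) \<longlonglongrightarrow> 0"
        using tendsto_norm[OF tendsto_diff[OF ylim tendsto_const[of w]]] True by simp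
      have 3: "filterlim (\<lambda>n. cmod (y n - w)) (at_right 0) sequentially"
        using 2 yw by (auto simp: filterlim_at)
      have "filterlim (\<lambda>n. cmod (1 - cnj w * y n) / cmod (y n - w)) at_top sequentially"
        using 1 3 nz unfolding divide_inverse
        by (intro filterlim_tendsto_pos_mult_at_top[OF 1] filterlim_compose[OF filterlim_inverse_at_top_right]) auto
      hence "filterlim (\<lambda>n. ln (cmod ((1 - cnj w * y n) / (y n - w)))) at_top sequentially"
        unfolding norm_divide by (rule filterlim_compose[OF ln_at_top])
      thus ?thesis using True by (simp add: green_def ennreal_tendsto_top_eq_at_top)
    qed
    thus ?thesis using yw by (simp add: green_def w_def[symmetric])
  qed
  let ?N = "restrict_space lborel {0..1::real}"
  have "(\<integral>\<^sup>+t. green z (circ s t) \<partial>?N) = (\<integral>\<^sup>+t. liminf (\<lambda>n. green (y n) (circ s t)) \<partial>?N)"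
    using lim by (intro nn_integral_cong lim_imp_Liminf[symmetric]) auto
  also have "\<dots> \<le> liminf (\<lambda>n. \<integral>\<^sup>+t. green (y n) (circ s t) \<partial>?N)"
    by (intro nn_integral_liminf measurable_restrict_space1) measurable
  also have "\<dots> = liminf (\<lambda>n. ennreal (ln (1 / cmod (y n))))"
    using s y1 by (simp add: green_circ_mean)
  also have "\<dots> = ennreal (ln (1 / s))"
  proof (rule lim_imp_Liminf)
    show "(\<lambda>n. ennreal (ln (1 / cmod (y n)))) \<longlonglongrightarrow> ennreal (ln (1 / s))"
      unfolding z[symmetric] using z s by (intro tendsto_ennrealI tendsto_intros ylim) auto
  qed simp
  finally show ?thesis .
qed

text \<open>The uniform measure on |\<zeta>| = s, transported by \<open>disk_moebius (- p)\<close>,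
  has potential at most ln (1 / s) on its support by conformal invariance. As it has mass 1, the
  same bound holds for its energy.\<close>

proposition green_V_le:
  fixes s :: real
  assumes p: "cmod p < 1" and s: "0 < s" "s < 1"
    and E: "\<And>z. cmod z < 1 \<Longrightarrow> cmod (disk_moebius p z) = s \<Longrightarrow> z \<in> E"
  shows "green_V E \<le> ennreal (ln (1 / s))"
proof -
  define N where "N = restrict_space lborel {0..1::real}"
  define \<psi> where "\<psi> = disk_moebius (- p)"
  have \<psi>1: "cmod (\<psi> z) < 1" if "cmod z < 1" for z unfolding \<psi>_def using p that by (intro moebius_in_disk) auto
  have \<psi>inv: "disk_moebius p (\<psi> z) = z" if "cmod z < 1" for z
    unfolding \<psi>_def using p that by (intro Moebius_function_compose) auto
  define \<mu> where "\<mu> = distr N borel (\<lambda>t. \<psi> (circ s t))"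
  define L where "L = \<psi> ` sphere 0 s"
  have meas: "(\<lambda>t. \<psi> (circ s t)) \<in> N \<rightarrow>\<^sub>M borel"
    unfolding \<psi>_def Moebius_function_simple N_def by (intro measurable_restrict_space1) measurable
  interpret N: prob_space N unfolding N_def by (intro prob_space_restrict_space) auto
  interpret \<mu>: prob_space \<mu> unfolding \<mu>_def by (rule N.prob_space_distr[OF meas])
  have L: "compact L"
    unfolding L_def \<psi>_def using s p
    by (intro compact_continuous_image continuous_on_subset[OF holomorphic_on_imp_continuous_on[OF Moebius_function_holomorphic]])
       auto
  have "L \<in> sets borel" using L by (intro borel_closed compact_imp_closed)
  have null: "emeasure \<mu> (UNIV - L) = 0"
  proof -
    have "(\<lambda>t. \<psi> (circ s t)) -` (UNIV - L) \<inter> space N = {}" using s by (auto simp: L_def)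
    thus ?thesis unfolding \<mu>_def using \<open>L \<in> sets borel\<close> by (subst emeasure_distr[OF meas]) auto
  qed
  have "\<mu> \<in> admissible_measures E"
    unfolding admissible_measures_def
  proof (intro CollectI conjI exI)
    show "L \<subseteq> E \<inter> unit_disk"
      using \<psi>1 \<psi>inv s by (auto simp: L_def intro!: E)
  qed (use L null \<mu>.prob_space_axioms in \<open>auto simp: \<mu>_def\<close>)
  hence "green_V E \<le> green_energy \<mu>" unfolding green_V_def by (rule INF_lower)
  also have "\<dots> \<le> (\<integral>\<^sup>+z. ennreal (ln (1 / s)) \<partial>\<mu>)"
    unfolding green_energy_def
  proof (rule nn_integral_mono_AE)
    have "AE z in \<mu>. z \<in> L"
      using null \<open>L \<in> sets borel\<close> by (intro AE_I[of _ _ "UNIV - L"]) (auto simp: \<mu>_def)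
    thus "AE z in \<mu>. (\<integral>\<^sup>+w. green z w \<partial>\<mu>) \<le> ennreal (ln (1 / s))"
    proof eventually_elim
      case (elim z)
      then obtain \<zeta> where \<zeta>: "z = \<psi> \<zeta>" "cmod \<zeta> = s" by (auto simp: L_def)
      have "(\<integral>\<^sup>+w. green z w \<partial>\<mu>) = (\<integral>\<^sup>+t. green z (\<psi> (circ s t)) \<partial>N)"
        unfolding \<mu>_def by (rule nn_integral_distr[OF meas]) measurable
      also have "\<dots> = (\<integral>\<^sup>+t. green \<zeta> (circ s t) \<partial>N)"
        unfolding \<zeta>(1) \<psi>_def using p s \<zeta>(2) by (intro nn_integral_cong green_moebius) auto
      also have "\<dots> \<le> ennreal (ln (1 / s))"
        unfolding N_def by (rule green_circ_potential_le[OF s \<zeta>(2)])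
      finally show ?case .
    qed
  qed
  also have "\<dots> = ennreal (ln (1 / s))" by (simp add: \<mu>.emeasure_space_1)
  finally show ?thesis .
qed

section \<open>Disks and fractional linear maps\<close>

text \<open>Completing the square in z in the inequality |z - p| <= s |1 - cnj p z| reveals the
  Euclidean centre and radius of a pseudohyperbolic disk.\<close>

lemma moebius_disk_identity:
  fixes p z :: complex and s :: real
  assumes p: "cmod p < 1" and s: "0 < s" "s < 1"
  defines "Dn \<equiv> 1 - s\<^sup>2 * (cmod p)\<^sup>2"
  shows "s\<^sup>2 * (cmod (1 - cnj p * z))\<^sup>2 - (cmod (z - p))\<^sup>2
       = Dn * ((s * (1 - (cmod p)\<^sup>2) / Dn)\<^sup>2 - (cmod (z - of_real ((1 - s\<^sup>2) / Dn) * p))\<^sup>2)"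
    and "0 < Dn"
proof -
  have "s * cmod p < 1" using scale_less_one[of s "cmod p"] p s by simp
  hence "(s * cmod p)\<^sup>2 < 1" using s by (simp add: abs_square_less_1)
  thus D: "0 < Dn" by (simp add: Dn_def power_mult_distrib)
  obtain x y where p': "p = Complex x y" by (cases p)
  obtain X Y where z': "z = Complex X Y" by (cases z)
  define P where "P = x\<^sup>2 + y\<^sup>2"
  have P: "(cmod p)\<^sup>2 = P" by (simp add: P_def p' cmod_power2)
  have "Dn * ((s * (1 - P) / Dn)\<^sup>2 - (cmod (z - of_real ((1 - s\<^sup>2) / Dn) * p))\<^sup>2) * Dn
      = (s * (1 - P))\<^sup>2 - ((Dn * X - (1 - s\<^sup>2) * x)\<^sup>2 + (Dn * Y - (1 - s\<^sup>2) * y)\<^sup>2)"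
  proof -
    have "z - of_real ((1 - s\<^sup>2) / Dn) * p = Complex ((Dn * X - (1 - s\<^sup>2) * x) / Dn) ((Dn * Y - (1 - s\<^sup>2) * y) / Dn)"
      using D by (simp add: complex_eq_iff p' z' field_simps)
    hence "(cmod (z - of_real ((1 - s\<^sup>2) / Dn) * p))\<^sup>2
        = ((Dn * X - (1 - s\<^sup>2) * x)\<^sup>2 + (Dn * Y - (1 - s\<^sup>2) * y)\<^sup>2) / Dn\<^sup>2"
      by (simp add: cmod_power2 power_divide add_divide_distrib)
    thus ?thesis using D by (simp add: power_divide power2_eq_square[of Dn] flip: diff_divide_distrib)
  qed
  also have "\<dots> = (s\<^sup>2 * ((1 - x * X - y * Y)\<^sup>2 + (x * Y - y * X)\<^sup>2) - ((X - x)\<^sup>2 + (Y - y)\<^sup>2)) * Dn"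
    unfolding Dn_def P unfolding P_def by algebra
  also have "s\<^sup>2 * ((1 - x * X - y * Y)\<^sup>2 + (x * Y - y * X)\<^sup>2) - ((X - x)\<^sup>2 + (Y - y)\<^sup>2)
      = s\<^sup>2 * (cmod (1 - cnj p * z))\<^sup>2 - (cmod (z - p))\<^sup>2"
    unfolding cmod_power2 by (simp add: p' z' power2_eq_square algebra_simps)
  finally show "s\<^sup>2 * (cmod (1 - cnj p * z))\<^sup>2 - (cmod (z - p))\<^sup>2
       = Dn * ((s * (1 - (cmod p)\<^sup>2) / Dn)\<^sup>2 - (cmod (z - of_real ((1 - s\<^sup>2) / Dn) * p))\<^sup>2)"
    using D by (simp add: P)
qed

lemma moebius_disk_eq:
  fixes p z :: complex and s :: real
  assumes p: "cmod p < 1" and s: "0 < s" "s < 1" and z: "cmod z < 1"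
  defines "c \<equiv> of_real ((1 - s\<^sup>2) / (1 - s\<^sup>2 * (cmod p)\<^sup>2)) * p"
    and "r \<equiv> s * (1 - (cmod p)\<^sup>2) / (1 - s\<^sup>2 * (cmod p)\<^sup>2)"
  shows "cmod (disk_moebius p z) \<le> s \<longleftrightarrow> z \<in> cball c r"
    and "cmod (disk_moebius p z) < s \<longleftrightarrow> z \<in> ball c r"
proof -
  define Dn where "Dn = 1 - s\<^sup>2 * (cmod p)\<^sup>2"
  note id = moebius_disk_identity(1)[OF p s, of z, folded Dn_def] moebius_disk_identity(2)[OF p s, folded Dn_def]
  have nz: "0 < cmod (1 - cnj p * z)" using one_minus_cnj_mult_nonzero[of p z] p z by simp
  have r0: "0 \<le> r" unfolding r_def using id(2) s p by (simp add: Dn_def power_le_one)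
  have id1: "(s * cmod (1 - cnj p * z))\<^sup>2 - (cmod (z - p))\<^sup>2 = Dn * (r\<^sup>2 - (cmod (z - c))\<^sup>2)"
    using id(1) by (simp add: c_def r_def Dn_def power_mult_distrib)
  have m: "cmod (disk_moebius p z) = cmod (z - p) / cmod (1 - cnj p * z)"
    by (simp add: Moebius_function_simple norm_divide)
  have "cmod (disk_moebius p z) \<le> s \<longleftrightarrow> cmod (z - p) \<le> s * cmod (1 - cnj p * z)"
    unfolding m using nz by (simp add: divide_le_eq)
  also have "\<dots> \<longleftrightarrow> (cmod (z - p))\<^sup>2 \<le> (s * cmod (1 - cnj p * z))\<^sup>2"
    using s by (intro power_mono_iff[symmetric]) auto
  also have "\<dots> \<longleftrightarrow> 0 \<le> Dn * (r\<^sup>2 - (cmod (z - c))\<^sup>2)" unfolding id1[symmetric] by linarith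
  also have "\<dots> \<longleftrightarrow> (cmod (z - c))\<^sup>2 \<le> r\<^sup>2" using id(2) by (simp add: zero_le_mult_iff)
  also have "\<dots> \<longleftrightarrow> cmod (z - c) \<le> r" using r0 by (intro power_mono_iff) auto
  finally show "cmod (disk_moebius p z) \<le> s \<longleftrightarrow> z \<in> cball c r"
    by (simp add: dist_norm norm_minus_commute)
  have sq: "x < y \<longleftrightarrow> x\<^sup>2 < y\<^sup>2" if "0 \<le> x" "0 \<le> y" for x y :: real
    using power_mono_iff[of y x 2] that by (simp add: not_le[symmetric])
  have "cmod (disk_moebius p z) < s \<longleftrightarrow> cmod (z - p) < s * cmod (1 - cnj p * z)"
    unfolding m using nz by (simp add: divide_less_eq)
  also have "\<dots> \<longleftrightarrow> (cmod (z - p))\<^sup>2 < (s * cmod (1 - cnj p * z))\<^sup>2"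
    using s by (intro sq) auto
  also have "\<dots> \<longleftrightarrow> 0 < Dn * (r\<^sup>2 - (cmod (z - c))\<^sup>2)" unfolding id1[symmetric] by linarith
  also have "\<dots> \<longleftrightarrow> (cmod (z - c))\<^sup>2 < r\<^sup>2" using id(2) by (simp add: zero_less_mult_iff)
  also have "\<dots> \<longleftrightarrow> cmod (z - c) < r" using r0 by (intro sq[symmetric]) auto
  finally show "cmod (disk_moebius p z) < s \<longleftrightarrow> z \<in> ball c r"
    by (simp add: dist_norm norm_minus_commute)
qed

text \<open>On the diameter [c - r, c + r] of a disk centred on the real axis, t is the hyperbolic
  midpoint and s its pseudohyperbolic distance to the ends, which are (t - s) / (1 - ts) and (t + s)
  / (1 + ts). The substitution x -> (1 + x) / (1 - x) turns this addition law into multiplication;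
  hence the square roots of a b and a / b.\<close>

lemma pseudohyperbolic_parameters:
  fixes c r :: real
  assumes "0 < r" "0 \<le> c" "c + r < 1"
  obtains t s where "\<bar>t\<bar> < 1" "0 < s" "s < 1"
    "c = (1 - s\<^sup>2) / (1 - s\<^sup>2 * t\<^sup>2) * t" "r = s * (1 - t\<^sup>2) / (1 - s\<^sup>2 * t\<^sup>2)"
proof -
  define a where "a = (1 + (c + r)) / (1 - (c + r))"
  define b where "b = (1 + (c - r)) / (1 - (c - r))"
  define A where "A = sqrt (a * b)"
  define B where "B = sqrt (a / b)"
  have b: "0 < b" using assms by (simp add: b_def)
  have ab: "b < a" unfolding a_def b_def using assms by (intro frac_less2) auto
  have a: "0 < a" using ab b by simp
  have A: "0 < A" using a b by (simp add: A_def)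
  have B: "1 < B" using ab b by (simp add: B_def)
  have AB: "A * B = a" "A / B = b"
    using a b by (simp_all add: A_def B_def flip: real_sqrt_mult real_sqrt_divide)
  define k where "k = 2 / ((A + 1) * (B + 1))"
  have k: "k \<noteq> 0" using A B by (simp add: k_def)
  define t where "t = (A - 1) / (A + 1)"
  define s where "s = (B - 1) / (B + 1)"
  have t: "\<bar>t\<bar> < 1" using A by (auto simp: t_def abs_less_iff field_simps)
  have s: "0 < s" "s < 1" using B by (auto simp: s_def field_simps)
  have "\<bar>s * t\<bar> < 1 * 1" unfolding abs_mult using s t by (intro mult_strict_mono) auto
  hence st: "0 < 1 + t * s" "0 < 1 - t * s" by (auto simp: abs_less_iff mult.commute)
  have "c + r = (a - 1) / (a + 1)" using assms by (simp add: a_def field_simps)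
  also have "\<dots> = (t + s) / (1 + t * s)"
  proof -
    have "t + s = (A * B - 1) * k" "1 + t * s = (A * B + 1) * k"
      using A B by (simp_all add: t_def s_def k_def divide_simps) (simp_all add: algebra_simps)
    thus ?thesis using k unfolding AB(1) by simp
  qed
  finally have X: "c + r = (t + s) / (1 + t * s)" .
  have "c - r = (b - 1) / (b + 1)" using assms by (simp add: b_def field_simps)
  also have "\<dots> = (t - s) / (1 - t * s)"
  proof -
    have "t - s = (A - B) * k" "1 - t * s = (A + B) * k"
      using A B by (simp_all add: t_def s_def k_def divide_simps) (simp_all add: algebra_simps)
    moreover have "(b - 1) / (b + 1) = (A - B) / (A + B)"
      using A B by (simp add: AB(2)[symmetric] divide_simps)
    ultimately show ?thesis using k by simp
  qed
  finally have Y: "c - r = (t - s) / (1 - t * s)" .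
  have D: "1 - s\<^sup>2 * t\<^sup>2 = (1 + t * s) * (1 - t * s)" by algebra
  have "c = ((c + r) + (c - r)) / 2" by simp
  also have "\<dots> = (1 - s\<^sup>2) / (1 - s\<^sup>2 * t\<^sup>2) * t"
    unfolding X Y D using st by (simp add: divide_simps) (simp add: algebra_simps power2_eq_square)
  finally have c: "c = (1 - s\<^sup>2) / (1 - s\<^sup>2 * t\<^sup>2) * t" .
  have "r = ((c + r) - (c - r)) / 2" by simp
  also have "\<dots> = s * (1 - t\<^sup>2) / (1 - s\<^sup>2 * t\<^sup>2)"
    unfolding X Y D using st by (simp add: divide_simps) (simp add: algebra_simps power2_eq_square)
  finally show thesis using that[OF t s c] by blast
qed

lemma moebius_disk_of_ball:
  fixes c :: complex and r :: real
  assumes r: "0 < r" and cr: "cmod c + r < 1"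
  obtains p s where "cmod p < 1" "0 < s" "s < 1"
    "\<And>z. cmod z < 1 \<Longrightarrow> cmod (disk_moebius p z) \<le> s \<longleftrightarrow> z \<in> cball c r"
    "\<And>z. cmod z < 1 \<Longrightarrow> cmod (disk_moebius p z) < s \<longleftrightarrow> z \<in> ball c r"
proof -
  obtain t s where ts: "\<bar>t\<bar> < 1" "0 < s" "s < 1"
    "cmod c = (1 - s\<^sup>2) / (1 - s\<^sup>2 * t\<^sup>2) * t" "r = s * (1 - t\<^sup>2) / (1 - s\<^sup>2 * t\<^sup>2)"
    using pseudohyperbolic_parameters[of r "cmod c"] assms by auto
  \<comment> \<open>The direction of the centre; for \<open>c = 0\<close>, where \<open>sgn\<close>
    is 0, any unit vector serves.\<close>
  define e where "e = (if c = 0 then 1 else sgn c)"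
  have e: "cmod e = 1" "c = of_real (cmod c) * e"
    by (simp add: e_def norm_sgn) (simp add: e_def sgn_eq)
  define p where "p = of_real t * e"
  have p: "(cmod p)\<^sup>2 = t\<^sup>2" "cmod p < 1" using ts(1) e by (auto simp: p_def norm_mult)
  have c: "of_real ((1 - s\<^sup>2) / (1 - s\<^sup>2 * (cmod p)\<^sup>2)) * p = c"
    unfolding p(1) by (subst e(2), subst ts(4)) (simp add: p_def)
  have r: "s * (1 - (cmod p)\<^sup>2) / (1 - s\<^sup>2 * (cmod p)\<^sup>2) = r" by (simp add: ts(5) p)
  show thesis
    using that[OF p(2) ts(2,3)] moebius_disk_eq[OF p(2) ts(2,3)] unfolding c r by blast
qed

text \<open>As t -> 1, the pseudohyperbolic disk of radius s about t e shrinks towards the tangency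
  point e. The ends of its diameter along e are (t - s) / (1 - ts), which tends to 1, and (t + s) /
  (1 + ts) < 1; for t near 1 both lie strictly inside the diameter of the ball.\<close>

lemma moebius_disk_in_tangent_ball:
  fixes c :: complex and r s :: real
  assumes r: "0 < r" and cr: "cmod c + r = 1" and s: "0 < s" "s < 1"
  obtains p where "cmod p < 1" "\<And>z. cmod z < 1 \<Longrightarrow> cmod (disk_moebius p z) \<le> s \<Longrightarrow> z \<in> ball c r"
proof -
  have "((\<lambda>t. (t - s) / (1 - t * s)) \<longlongrightarrow> (1 - s) / (1 - 1 * s)) (at_left 1)"
    using s by (intro tendsto_intros) auto
  \<comment> \<open>Here 1 - 2r = \<open>cmod c - r\<close> is the end of the ball's diameter
    opposite to the tangency point.\<close>
  moreover have "1 - 2 * r < (1 - s) / (1 - 1 * s)" using r s by simp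
  ultimately have "\<forall>\<^sub>F t in at_left 1. 1 - 2 * r < (t - s) / (1 - t * s)"
    by (rule order_tendstoD)
  moreover have "eventually (\<lambda>t::real. 0 < t \<and> t < 1) (at_left 1)"
    by (intro eventually_conj eventually_at_leftI[of 0]) auto
  ultimately have "\<forall>\<^sub>F t in at_left 1. 0 < t \<and> t < 1 \<and> 1 - 2 * r < (t - s) / (1 - t * s)"
    by eventually_elim auto
  then obtain t where t: "0 < t" "t < 1" "1 - 2 * r < (t - s) / (1 - t * s)"
    by (auto dest!: eventually_happens'[OF trivial_limit_at_left_real])
  define e where "e = (if c = 0 then 1 else sgn c)"
  have e: "cmod e = 1" "c = of_real (cmod c) * e"
    by (simp add: e_def norm_sgn) (simp add: e_def sgn_eq)
  define p where "p = of_real t * e"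
  have p: "(cmod p)\<^sup>2 = t\<^sup>2" "cmod p < 1" using t e by (auto simp: p_def norm_mult)
  define \<gamma> where "\<gamma> = (1 - s\<^sup>2) / (1 - s\<^sup>2 * t\<^sup>2) * t"
  define \<rho> where "\<rho> = s * (1 - t\<^sup>2) / (1 - s\<^sup>2 * t\<^sup>2)"
  have "t * s < 1 * 1" using s t by (intro mult_strict_mono) auto
  hence st: "0 < 1 - t * s" "0 < 1 + t * s" using s t by (auto intro: add_pos_pos)
  have D: "1 - s\<^sup>2 * t\<^sup>2 = (1 + t * s) * (1 - t * s)" by algebra
  have "\<gamma> - \<rho> = (t - s) / (1 - t * s)"
    unfolding \<gamma>_def \<rho>_def D using st by (simp add: divide_simps) (simp add: algebra_simps power2_eq_square)
  hence lo: "cmod c - r < \<gamma> - \<rho>" using t cr by simp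
  have "\<gamma> + \<rho> = (t + s) / (1 + t * s)"
    unfolding \<gamma>_def \<rho>_def D using st by (simp add: divide_simps) (simp add: algebra_simps power2_eq_square)
  also have "\<dots> < 1"
  proof -
    have "0 < (1 - t) * (1 - s)" using s t by simp
    thus ?thesis using st by (simp add: algebra_simps)
  qed
  finally have hi: "\<gamma> + \<rho> < cmod c + r" using cr by simp
  show thesis
  proof (rule that[OF p(2)])
    fix z assume z: "cmod z < 1" "cmod (disk_moebius p z) \<le> s"
    have "z \<in> cball (of_real \<gamma> * e) \<rho>"
      using moebius_disk_eq(1)[OF p(2) s z(1)] z(2) unfolding p(1) by (simp add: \<gamma>_def \<rho>_def p_def mult.assoc)
    moreover have "cmod (of_real \<gamma> * e - c) = \<bar>\<gamma> - cmod c\<bar>"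
    proof -
      have "of_real \<gamma> * e - c = of_real (\<gamma> - cmod c) * e"
        by (subst e(2)) (simp add: algebra_simps)
      thus ?thesis using e(1) by (simp add: norm_mult del: of_real_diff)
    qed
    moreover have "dist c z \<le> dist c (of_real \<gamma> * e) + dist (of_real \<gamma> * e) z"
      by (rule dist_triangle)
    ultimately show "z \<in> ball c r" using lo hi by (simp add: dist_norm norm_minus_commute)
  qed
qed

section \<open>From disk images to the limit of n-th roots\<close>

text \<open>Constants tend to 1 under n-th roots. The lower bound is asked only at rates below
  \<beta>, with a constant depending on the rate, because in the tangent case no pseudohyperbolic
  disk of radius 1 is at hand.\<close>

lemma root_limit:
  fixes a :: "nat \<Rightarrow> real"
  assumes \<beta>: "0 < \<beta>" "\<beta> \<le> 1" and up: "\<And>m. a (Suc m) \<le> C * \<beta> ^ m"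
    and low: "\<And>s. 0 < s \<Longrightarrow> s < \<beta> \<Longrightarrow> \<exists>c>0. \<forall>m. s ^ m \<le> c * a (Suc m)"
  shows "(\<lambda>n. a n powr (1 / real n)) \<longlonglongrightarrow> \<beta>"
proof -
  have root1: "(\<lambda>n. x powr (1 / real n) * y) \<longlonglongrightarrow> y" if "0 < x" for x y :: real
  proof -
    have "(\<lambda>n. x powr (1 / real n) * y) \<longlonglongrightarrow> x powr 0 * y"
      using that by (intro tendsto_intros lim_1_over_n) auto
    thus ?thesis using that by simp
  qed
  have pow: "(x * y ^ n) powr (1 / real n) = x powr (1 / real n) * y" if "0 < x" "0 < y" "0 < n" for x y :: real and n
    using that by (simp add: powr_mult powr_powr flip: powr_realpow)
  have lower: "\<exists>x>0. \<forall>n>0. x * s ^ n \<le> a n" if s: "0 < s" "s < \<beta>" for s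
  proof -
    obtain c where c: "c > 0" "\<And>m. s ^ m \<le> c * a (Suc m)" using low[OF s] by auto
    have "1 / c * s ^ n \<le> a n" if "0 < n" for n
    proof -
      have "s ^ n \<le> s ^ (n - 1)" using s \<beta> by (intro power_decreasing) auto
      also have "\<dots> \<le> c * a n" using c(2)[of "n - 1"] that by simp
      finally show ?thesis using c(1) by (simp add: field_simps)
    qed
    thus ?thesis using c(1) by (intro exI[of _ "1 / c"]) auto
  qed
  have apos: "0 < a n" if "0 < n" for n
  proof -
    obtain x where x: "x > 0" "\<forall>n>0. x * (\<beta> / 2) ^ n \<le> a n" using lower[of "\<beta> / 2"] \<beta> by auto
    have "0 < x * (\<beta> / 2) ^ n" using x(1) \<beta> by simp
    thus ?thesis using x(2) that by (meson less_le_trans)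
  qed
  show ?thesis
  proof (rule order_tendstoI)
    fix y assume y: "y < \<beta>"
    define s where "s = (max y 0 + \<beta>) / 2"
    have s: "0 < s" "s < \<beta>" "y < s" using y \<beta> by (auto simp: s_def)
    obtain x where x: "x > 0" "\<And>n. 0 < n \<Longrightarrow> x * s ^ n \<le> a n" using lower[OF s(1,2)] by auto
    have "\<forall>\<^sub>F n in sequentially. y < x powr (1 / real n) * s"
      using order_tendstoD(1)[OF root1[OF x(1)] s(3)] .
    thus "\<forall>\<^sub>F n in sequentially. y < a n powr (1 / real n)"
      using eventually_gt_at_top[of 0]
    proof eventually_elim
      case (elim n)
      have "x powr (1 / real n) * s = (x * s ^ n) powr (1 / real n)" using pow x s elim by simp
      also have "\<dots> \<le> a n powr (1 / real n)" using x s elim by (intro powr_mono2) auto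
      finally show ?case using elim by simp
    qed
  next
    fix y assume y: "\<beta> < y"
    have C: "0 < C" using apos[of 1] up[of 0] by simp
    have "\<forall>\<^sub>F n in sequentially. (C / \<beta>) powr (1 / real n) * \<beta> < y"
      using order_tendstoD(2)[OF root1[of "C / \<beta>"] y] C \<beta> by simp
    thus "\<forall>\<^sub>F n in sequentially. a n powr (1 / real n) < y"
      using eventually_gt_at_top[of 0]
    proof eventually_elim
      case (elim n)
      then obtain m where n: "n = Suc m" by (cases n) auto
      \<comment> \<open>The index shift between \<open>a (Suc m)\<close> and
        \<open>\<beta> ^ m\<close> is absorbed by passing from \<open>C\<close> to
        \<open>C / \<beta>\<close>.\<close>
      have "a n \<le> C / \<beta> * \<beta> ^ n" using up[of m] \<beta> by (simp add: n)
      hence "a n powr (1 / real n) \<le> (C / \<beta> * \<beta> ^ n) powr (1 / real n)"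
        using apos[of n] elim by (intro powr_mono2) auto
      also have "\<dots> = (C / \<beta>) powr (1 / real n) * \<beta>" using C \<beta> elim by (intro pow) auto
      finally show ?case using elim by simp
    qed
  qed
qed

lemma moebius_holomorphic: "cmod p < 1 \<Longrightarrow> disk_moebius p holomorphic_on unit_disk"
  by (rule Moebius_function_holomorphic)

text \<open>Here \<tau> is \<open>disk_moebius p\<close> after \<phi>, divided by s. The strict
  inequality in \<open>img\<close> makes it a self-map of the open disk.\<close>

lemma approx_num_upper_moebius:
  fixes s :: real
  assumes \<phi>: "\<phi> holomorphic_on unit_disk" "\<phi> ` unit_disk \<subseteq> unit_disk"
    and p: "cmod p < 1" and s: "0 < s" "s \<le> 1"
    and img: "\<And>z. z \<in> \<phi> ` unit_disk \<Longrightarrow> cmod (disk_moebius p z) < s"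
  obtains C where "\<And>m. approx_num_ext (comp_op \<phi>) (Suc m) \<le> ereal (C * s ^ m)"
proof (rule approx_num_comp_op_le)
  show "(\<lambda>z. disk_moebius p (\<phi> z) / of_real s) holomorphic_on unit_disk"
    using holomorphic_on_compose_gen[OF \<phi>(1) moebius_holomorphic[OF p] \<phi>(2)] s
    by (intro holomorphic_intros) (auto simp: o_def)
  show "(\<lambda>z. disk_moebius p (\<phi> z) / of_real s) ` unit_disk \<subseteq> unit_disk"
    using img s by (auto simp: norm_divide)
  show "disk_moebius (- p) holomorphic_on unit_disk" "disk_moebius (- p) ` unit_disk \<subseteq> unit_disk"
    using p by (auto intro!: moebius_holomorphic moebius_in_disk)
  show "\<phi> z = disk_moebius (- p) (of_real s * (disk_moebius p (\<phi> z) / of_real s))" if "z \<in> unit_disk" for z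
  proof -
    have "cmod (\<phi> z) < 1" using \<phi>(2) that by force
    thus ?thesis using p s by (simp add: Moebius_function_compose)
  qed
qed (use s that in auto)

text \<open>The dilation is recovered from \<phi> with \<theta> = \<open>disk_moebius p\<close> and
  \<sigma> = \<open>g\<close> after \<open>h\<close>, where \<open>g\<close> inverts \<phi> and
  \<open>h\<close> maps the disk onto the open pseudohyperbolic disk about \<open>p\<close> of
  radius s, which lies in the image of \<phi>.\<close>

lemma approx_num_lower_moebius:
  fixes s :: real
  assumes \<phi>: "\<phi> holomorphic_on unit_disk" "\<phi> ` unit_disk \<subseteq> unit_disk" "inj_on \<phi> unit_disk"
    and p: "cmod p < 1" and s: "0 < s" "s \<le> 1"
    and img: "\<And>z. cmod z < 1 \<Longrightarrow> cmod (disk_moebius p z) < s \<Longrightarrow> z \<in> \<phi> ` unit_disk"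
  obtains C where "0 < C" "\<And>m. ereal (s ^ m) \<le> ereal C * approx_num_ext (comp_op \<phi>) (Suc m)"
proof -
  obtain g where g: "g holomorphic_on \<phi> ` unit_disk" "\<And>z. z \<in> unit_disk \<Longrightarrow> g (\<phi> z) = z"
    using holomorphic_has_inverse[OF \<phi>(1) open_ball \<phi>(3)] by metis
  define h where "h = (\<lambda>z. disk_moebius (- p) (of_real s * z))"
  have sz: "cmod (of_real s * z) < 1" if "z \<in> unit_disk" for z
    using that s by (auto simp: norm_mult intro!: scale_less_one)
  have inv: "disk_moebius p (h z) = of_real s * z" if "z \<in> unit_disk" for z
    unfolding h_def using p sz[OF that] by (intro Moebius_function_compose) auto
  have h1: "cmod (h z) < 1" if "z \<in> unit_disk" for z
    unfolding h_def using p sz[OF that] by (intro moebius_in_disk) auto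
  have hh: "h holomorphic_on unit_disk"
    unfolding h_def using p sz
    by (intro holomorphic_on_compose_gen[OF _ moebius_holomorphic[of "- p"], unfolded o_def] holomorphic_intros) auto
  have himg: "h z \<in> \<phi> ` unit_disk" if "z \<in> unit_disk" for z
  proof (rule img[OF h1[OF that]])
    have "s * cmod z < s * 1" using that s by (intro mult_strict_left_mono) auto
    thus "cmod (disk_moebius p (h z)) < s" using s by (simp add: inv[OF that] norm_mult)
  qed
  show thesis
  proof (rule approx_num_comp_op_ge[OF \<phi>(1,2) _ _ moebius_holomorphic[OF p] _ s])
    show "(\<lambda>z. g (h z)) holomorphic_on unit_disk"
      using himg by (intro holomorphic_on_compose_gen[OF hh g(1), unfolded o_def]) auto
    show "(\<lambda>z. g (h z)) ` unit_disk \<subseteq> unit_disk" using himg g(2) by force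
    show "disk_moebius p ` unit_disk \<subseteq> unit_disk" using p by (auto intro!: moebius_in_disk)
    show "disk_moebius p (\<phi> (g (h z))) = of_real s * z" if "z \<in> unit_disk" for z
    proof -
      obtain x where "x \<in> unit_disk" "h z = \<phi> x" using himg[OF \<open>z \<in> unit_disk\<close>] by auto
      thus ?thesis using g(2) inv[OF \<open>z \<in> unit_disk\<close>] by simp
    qed
  qed (use that in auto)
qed

lemma exp_neg_inv_green_cap:
  assumes "green_V E = ennreal (ln (1 / s))" "0 < s" "s \<le> 1"
  shows "exp_neg_inv (green_cap E) = s"
proof (cases "s = 1")
  case True thus ?thesis using assms by (simp add: green_cap_def exp_neg_inv_def)
next
  case False
  hence l: "0 < ln (1 / s)" using assms by simp
  hence "green_cap E = ennreal (1 / ln (1 / s))"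
    using assms by (simp add: green_cap_def inverse_ennreal inverse_eq_divide ennreal_eq_0_iff)
  moreover have "exp (- 1 / (1 / ln (1 / s))) = s" using assms by (simp add: ln_div)
  ultimately show ?thesis using l by (simp add: exp_neg_inv_def ennreal_eq_0_iff)
qed

proposition approx_num_limit_disk_image:
  assumes \<phi>: "\<phi> holomorphic_on unit_disk" "inj_on \<phi> unit_disk" "\<phi> ` unit_disk = ball c r"
    and r: "0 < r" and cr: "cmod c + r \<le> 1"
  shows "(\<lambda>n. approx_num (comp_op \<phi>) n powr (1 / real n)) \<longlonglongrightarrow> exp_neg_inv (green_cap (cball c r))"
proof -
  have sub: "\<phi> ` unit_disk \<subseteq> unit_disk"
    unfolding \<phi>(3) using cr by (subst ball_subset_ball_iff) (auto simp: dist_norm)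
  have limit: "(\<lambda>n. approx_num (comp_op \<phi>) n powr (1 / real n)) \<longlonglongrightarrow> \<beta>"
    if \<beta>: "0 < \<beta>" "\<beta> \<le> 1"
      and up: "\<And>m. approx_num_ext (comp_op \<phi>) (Suc m) \<le> ereal (C * \<beta> ^ m)"
      and low: "\<And>s. 0 < s \<Longrightarrow> s < \<beta> \<Longrightarrow>
                 \<exists>c>0. \<forall>m. ereal (s ^ m) \<le> ereal c * approx_num_ext (comp_op \<phi>) (Suc m)" for \<beta> C
  proof (rule root_limit[OF \<beta>])
    \<comment> \<open>\<open>real_of_ereal\<close> would send infinite values to 0; the lower bound
      rules out minus infinity and the upper bound plus infinity.\<close>
    have fin: "approx_num_ext (comp_op \<phi>) (Suc m) = ereal (approx_num (comp_op \<phi>) (Suc m))" for m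
    proof -
      obtain k where k: "k > 0" "ereal ((\<beta> / 2) ^ m) \<le> ereal k * approx_num_ext (comp_op \<phi>) (Suc m)"
        using low[of "\<beta> / 2"] \<beta> by auto
      have "approx_num_ext (comp_op \<phi>) (Suc m) \<noteq> - \<infinity>" using k by auto
      moreover have "approx_num_ext (comp_op \<phi>) (Suc m) \<noteq> \<infinity>" using up[of m] by auto
      ultimately show ?thesis unfolding approx_num_def by (cases "approx_num_ext (comp_op \<phi>) (Suc m)") auto
    qed
    show "approx_num (comp_op \<phi>) (Suc m) \<le> C * \<beta> ^ m" for m using up[of m] by (simp add: fin)
    show "\<exists>c>0. \<forall>m. s ^ m \<le> c * approx_num (comp_op \<phi>) (Suc m)" if "0 < s" "s < \<beta>" for s
      using low[OF that] by (simp add: fin)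
  qed
  show ?thesis
  proof (cases "cmod c + r < 1")
    case True
    obtain p s where p: "cmod p < 1" and s: "0 < s" "s < 1"
      and cb: "\<And>z. cmod z < 1 \<Longrightarrow> cmod (disk_moebius p z) \<le> s \<longleftrightarrow> z \<in> cball c r"
      and b: "\<And>z. cmod z < 1 \<Longrightarrow> cmod (disk_moebius p z) < s \<longleftrightarrow> z \<in> ball c r"
      using moebius_disk_of_ball[OF r True] by metis
    have "green_V (cball c r) = ennreal (ln (1 / s))"
    proof (rule antisym)
      show "green_V (cball c r) \<le> ennreal (ln (1 / s))"
        by (rule green_V_le[OF p s]) (metis cb order_refl)
      show "ennreal (ln (1 / s)) \<le> green_V (cball c r)"
        by (rule green_V_ge[OF p s]) (metis cb)
    qed
    hence e: "exp_neg_inv (green_cap (cball c r)) = s" using s by (intro exp_neg_inv_green_cap) auto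
    have s1: "s \<le> 1" using s by simp
    obtain C where C: "\<And>m. approx_num_ext (comp_op \<phi>) (Suc m) \<le> ereal (C * s ^ m)"
      using approx_num_upper_moebius[OF \<phi>(1) sub p s(1) s1] b sub unfolding \<phi>(3)
      by (metis mem_ball_0 subsetD)
    show ?thesis unfolding e
    proof (rule limit[OF s(1) s1 C])
      fix s' assume s': "0 < s'" "s' < s"
      have "s' \<le> 1" using s' s by simp
      then obtain k where "0 < k" "\<And>m. ereal (s' ^ m) \<le> ereal k * approx_num_ext (comp_op \<phi>) (Suc m)"
        using approx_num_lower_moebius[OF \<phi>(1) sub \<phi>(2) p s'(1)] b s'(2) unfolding \<phi>(3)
        by (metis less_trans)
      thus "\<exists>c>0. \<forall>m. ereal (s' ^ m) \<le> ereal c * approx_num_ext (comp_op \<phi>) (Suc m)" by blast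
    qed
  next
    case False
    hence tan: "cmod c + r = 1" using cr by simp
    \<comment> \<open>The closed disk meets the unit circle, but admissible measures live on compact
      subsets of the open disk. Pseudohyperbolic circles of radius s inside the ball supply them,
      with energies at most ln (1 / s) -> 0.\<close>
    have "green_V (cball c r) = 0"
    proof (rule antisym)
      show "green_V (cball c r) \<le> 0"
      proof (rule tendsto_lowerbound)
        have "((\<lambda>s. ennreal (ln (1 / s))) \<longlongrightarrow> ennreal (ln (1 / 1))) (at_left (1::real))"
          by (intro tendsto_ennrealI tendsto_intros) auto
        thus "((\<lambda>s. ennreal (ln (1 / s))) \<longlongrightarrow> 0) (at_left (1::real))" by simp
        have "green_V (cball c r) \<le> ennreal (ln (1 / s))" if s: "0 < s" "s < 1" for s
        proof -
          obtain p where p: "cmod p < 1" "\<And>z. cmod z < 1 \<Longrightarrow> cmod (disk_moebius p z) \<le> s \<Longrightarrow> z \<in> ball c r"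
            using moebius_disk_in_tangent_ball[OF r tan s] by metis
          show ?thesis by (rule green_V_le[OF p(1) s]) (metis p(2) order_refl ball_subset_cball subsetD)
        qed
        thus "\<forall>\<^sub>F s in at_left 1. green_V (cball c r) \<le> ennreal (ln (1 / s))"
          by (intro eventually_at_leftI[of 0]) auto
      qed simp
    qed simp
    hence e: "exp_neg_inv (green_cap (cball c r)) = 1" by (intro exp_neg_inv_green_cap) auto
    \<comment> \<open>With p = 0 and s = 1 no decay is claimed: this is boundedness of the
      composition operator.\<close>
    obtain C where C: "\<And>m. approx_num_ext (comp_op \<phi>) (Suc m) \<le> ereal (C * 1 ^ m)"
    proof (rule approx_num_upper_moebius[OF \<phi>(1) sub, of 0 1])
      show "cmod (disk_moebius 0 z) < 1" if "z \<in> \<phi> ` unit_disk" for z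
        using that sub by (intro moebius_in_disk) auto
    qed auto
    show ?thesis unfolding e
    proof (rule limit[OF _ _ C])
      fix s :: real assume s: "0 < s" "s < 1"
      have s1: "s \<le> 1" using s by simp
      obtain p where p: "cmod p < 1" "\<And>z. cmod z < 1 \<Longrightarrow> cmod (disk_moebius p z) \<le> s \<Longrightarrow> z \<in> ball c r"
        using moebius_disk_in_tangent_ball[OF r tan s] by metis
      obtain k where "0 < k" "\<And>m. ereal (s ^ m) \<le> ereal k * approx_num_ext (comp_op \<phi>) (Suc m)"
        using approx_num_lower_moebius[OF \<phi>(1) sub \<phi>(2) p(1) s(1) s1] p(2) unfolding \<phi>(3)
        by (metis less_imp_le)
      thus "\<exists>c>0. \<forall>m. ereal (s ^ m) \<le> ereal c * approx_num_ext (comp_op \<phi>) (Suc m)" by blast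
    qed auto
  qed
qed

section \<open>The image of the disk under a fractional linear map\<close>

text \<open>On |z| = 1 the difference |cz + d|^2 - |az + b|^2 is a constant minus a term 2 Re (cnj v
  z) with v = cnj a b - cnj c d. Its minimum over the circle is the constant minus 2 |v|, and
  \<open>cond1\<close> says that this is nonnegative.\<close>

lemma fractional_linear_disk_image:
  fixes a b c d :: complex
  assumes nondeg: "a * d - b * c \<noteq> 0"
    and cond1: "(cmod a)\<^sup>2 + (cmod b)\<^sup>2 + 2 * cmod (cnj a * b - cnj c * d) \<le> (cmod c)\<^sup>2 + (cmod d)\<^sup>2"
    and cond2: "cmod c \<le> cmod d"
  defines "\<phi> \<equiv> (\<lambda>z. (a * z + b) / (c * z + d))"
  obtains w r where "0 < r" "cmod w + r \<le> 1" "\<phi> holomorphic_on unit_disk" "inj_on \<phi> unit_disk"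
    "\<phi> ` unit_disk = ball w r"
proof -
  have circle: "cmod (a * z + b) \<le> cmod (c * z + d)" if z: "cmod z = 1" for z
  proof -
    have ex: "(cmod (x * z + y))\<^sup>2 = (cmod x)\<^sup>2 + (cmod y)\<^sup>2 + 2 * Re (cnj (cnj x * y) * z)" for x y
    proof -
      have "(cmod (x * z + y))\<^sup>2 = (cmod (x * z))\<^sup>2 + (cmod y)\<^sup>2 + 2 * Re (cnj (cnj x * y) * z)"
        unfolding cmod_power2 by (simp add: power2_eq_square algebra_simps)
      thus ?thesis using z by (simp add: norm_mult)
    qed
    have "(cmod (c * z + d))\<^sup>2 - (cmod (a * z + b))\<^sup>2
        = (cmod c)\<^sup>2 + (cmod d)\<^sup>2 - (cmod a)\<^sup>2 - (cmod b)\<^sup>2 - 2 * Re (cnj (cnj a * b - cnj c * d) * z)"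
      unfolding ex by (simp add: algebra_simps)
    moreover have "Re (cnj (cnj a * b - cnj c * d) * z) \<le> cmod (cnj a * b - cnj c * d)"
      using complex_Re_le_cmod[of "cnj (cnj a * b - cnj c * d) * z"] z
      unfolding norm_mult complex_mod_cnj by simp
    ultimately have "(cmod (a * z + b))\<^sup>2 \<le> (cmod (c * z + d))\<^sup>2" using cond1 by linarith
    thus ?thesis by (rule power2_le_imp_le) simp
  qed
  have cd: "cmod c < cmod d"
  proof (rule ccontr)
    assume "\<not> cmod c < cmod d"
    hence eq: "cmod c = cmod d" using cond2 by simp
    have c0: "c \<noteq> 0" using eq nondeg by auto
    have "cmod (- d / c) = 1" using c0 by (simp add: norm_divide eq[symmetric])
    from circle[OF this] have "a * (- d / c) + b = 0" using c0 by simp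
    hence "a * d - b * c = 0" using c0 by (simp add: field_simps)
    thus False using nondeg by simp
  qed
  hence d0: "d \<noteq> 0" by auto
  have den: "c * z + d \<noteq> 0" if "cmod z \<le> 1" for z
  proof
    assume "c * z + d = 0"
    hence "c * z = - d" by (simp add: eq_neg_iff_add_eq_0)
    hence "cmod c * cmod z = cmod d" by (metis norm_minus_cancel norm_mult)
    thus False using cd that mult_left_le[of "cmod z" "cmod c"] by simp
  qed
  define q where "q = - cnj (c / d)"
  have q: "cmod q < 1" using cd d0 by (simp add: q_def norm_divide)
  define \<Delta> where "\<Delta> = d * cnj d - c * cnj c"
  have \<Delta>: "\<Delta> \<noteq> 0"
  proof -
    have "\<Delta> = of_real ((cmod d)\<^sup>2 - (cmod c)\<^sup>2)"
      unfolding \<Delta>_def by (simp flip: complex_norm_square)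
    moreover have "(cmod c)\<^sup>2 < (cmod d)\<^sup>2" using cd by (intro power_strict_mono) auto
    ultimately show ?thesis by (metis diff_gt_0_iff_gt less_irrefl of_real_eq_0_iff)
  qed
  define w where "w = (b * cnj d - a * cnj c) / \<Delta>"
  define \<kappa> where "\<kappa> = (a * d - b * c) * cnj d / (\<Delta> * d)"
  have \<kappa>: "\<kappa> \<noteq> 0" using nondeg d0 \<Delta> by (simp add: \<kappa>_def)
  have \<phi>_eq: "\<phi> z = w + \<kappa> * disk_moebius q z" if z: "z \<in> unit_disk" for z
  proof -
    have nz: "c * z + d \<noteq> 0" using den z by simp
    have "disk_moebius q z = (z + cnj c / cnj d) / (1 + c / d * z)"
      by (simp add: Moebius_function_simple q_def)
    also have "\<dots> = ((cnj d * z + cnj c) * d) / (cnj d * (c * z + d))"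
      using nz d0 by (simp add: divide_simps) (simp add: algebra_simps)
    finally have "\<kappa> * disk_moebius q z = (a * d - b * c) * (cnj d * z + cnj c) / (\<Delta> * (c * z + d))"
      using d0 \<Delta> nz by (simp add: \<kappa>_def)
    hence "w + \<kappa> * disk_moebius q z
        = ((b * cnj d - a * cnj c) * (c * z + d) + (a * d - b * c) * (cnj d * z + cnj c)) / (\<Delta> * (c * z + d))"
      using \<Delta> nz by (simp add: w_def add_divide_distrib)
    also have "(b * cnj d - a * cnj c) * (c * z + d) + (a * d - b * c) * (cnj d * z + cnj c) = \<Delta> * (a * z + b)"
      unfolding \<Delta>_def by (simp add: algebra_simps)
    finally show ?thesis using \<Delta> by (simp add: \<phi>_def)
  qed
  have mq: "disk_moebius q ` unit_disk = unit_disk"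
  proof (intro subset_antisym subsetI)
    fix z assume "z \<in> unit_disk"
    hence "z = disk_moebius q (disk_moebius (- q) z)" "disk_moebius (- q) z \<in> unit_disk"
      using q by (auto simp: Moebius_function_compose intro!: moebius_in_disk)
    thus "z \<in> disk_moebius q ` unit_disk" by blast
  qed (use q in \<open>auto intro!: moebius_in_disk\<close>)
  have mq_inj: "inj_on (disk_moebius q) unit_disk"
    using q by (intro inj_on_inverseI[of _ "disk_moebius (- q)"]) (auto intro: Moebius_function_compose)
  have hol: "\<phi> holomorphic_on cball 0 1"
    unfolding \<phi>_def by (intro holomorphic_intros) (use den in auto)
  have img: "\<phi> ` unit_disk = ball w (cmod \<kappa>)"
  proof -
    have "\<phi> ` unit_disk = (\<lambda>u. w + \<kappa> * u) ` disk_moebius q ` unit_disk"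
      unfolding image_image by (intro image_cong refl \<phi>_eq)
    also have "\<dots> = (\<lambda>u. w + \<kappa> * u) ` unit_disk" by (simp only: mq)
    also have "\<dots> = ball w (cmod \<kappa>)"
    proof (intro subset_antisym subsetI)
      fix x assume "x \<in> ball w (cmod \<kappa>)"
      hence "(x - w) / \<kappa> \<in> unit_disk" "x = w + \<kappa> * ((x - w) / \<kappa>)"
        using \<kappa> by (auto simp: dist_norm norm_divide norm_minus_commute)
      thus "x \<in> (\<lambda>u. w + \<kappa> * u) ` unit_disk" by blast
    qed (use \<kappa> in \<open>auto simp: dist_norm norm_mult\<close>)
    finally show ?thesis .
  qed
  \<comment> \<open>The circle inequality extends inside by the maximum principle, as the pole lies
    outside the closed disk; for a ball of positive radius the inclusion then yields |w| +
    |\<kappa>| <= 1.\<close>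
  have "ball w (cmod \<kappa>) \<subseteq> cball 0 1"
    unfolding img[symmetric]
  proof (rule image_subsetI)
    fix z assume z: "z \<in> unit_disk"
    have "cmod (\<phi> z) \<le> 1"
    proof (rule maximum_modulus_frontier[of \<phi> unit_disk])
      show "cmod (\<phi> x) \<le> 1" if "x \<in> frontier unit_disk" for x
        using that circle[of x] den[of x] by (auto simp: \<phi>_def norm_divide divide_le_eq)
    qed (use z hol in \<open>auto intro!: holomorphic_on_imp_continuous_on elim: holomorphic_on_subset\<close>)
    thus "\<phi> z \<in> cball 0 1" by simp
  qed
  hence "cmod w + cmod \<kappa> \<le> 1" using \<kappa> by (auto simp: ball_subset_cball_iff)
  moreover have "inj_on \<phi> unit_disk"
    using mq_inj \<kappa> by (auto simp: inj_on_def \<phi>_eq)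
  moreover have "\<phi> holomorphic_on unit_disk" by (rule holomorphic_on_subset[OF hol]) auto
  ultimately show thesis using that[of "cmod \<kappa>" w] img \<kappa> by simp
qed

theorem theorem3p2:
  fixes a b c d :: complex
  assumes nondeg: "a * d - b * c \<noteq> 0"
    and cond1: "(cmod a)\<^sup>2 + (cmod b)\<^sup>2 + 2 * cmod (cnj a * b - cnj c * d) \<le> (cmod c)\<^sup>2 + (cmod d)\<^sup>2"
    and cond2: "cmod c \<le> cmod d"
  defines "\<phi> \<equiv> (\<lambda>z. (a * z + b) / (c * z + d))"
  defines "K \<equiv> closure (\<phi> ` unit_disk)"
  shows "(\<lambda>n. approx_num (comp_op \<phi>) n powr (1 / real n))
           \<longlonglongrightarrow> exp_neg_inv (green_cap K)"
proof -
  obtain w r where wr: "0 < r" "cmod w + r \<le> 1" "\<phi> holomorphic_on unit_disk" "inj_on \<phi> unit_disk"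
    "\<phi> ` unit_disk = ball w r"
    using fractional_linear_disk_image[OF nondeg cond1 cond2] unfolding \<phi>_def by metis
  have "K = cball w r" unfolding K_def wr(5) using wr(1) by simp
  thus ?thesis using approx_num_limit_disk_image[OF wr(3,4,5,1,2)] by simp
qed

end
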